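(* There exists $\beta_0$ such that for every $\beta>\beta_0$, the fraction of matroids on the ground set $[n]=\{1,\dots,n\}$ whose rank $r$ satisfies $n/2-\beta\sqrt{n} < r < n/2+\beta\sqrt{n}$ tends to $1$ as $n\to\infty$.
   Context: Matroids are counted as distinct set systems on the fixed labelled ground set $[n]$ (not up to isomorphism); the fraction is taken among all matroids on $[n]$. *)

theory Defs
  imports "HOL-Analysis.Analysis"
begin

(* A matroid on E is given by its family of bases. *)
definition matroid :: "'a set \<Rightarrow> 'a set set \<Rightarrow> bool" where
  "matroid E \<B> \<longleftrightarrow>
     finite E \<and> \<B> \<subseteq> Pow E \<and> \<B> \<noteq> {} \<and>
     (\<forall>A\<in>\<B>. \<forall>B\<in>\<B>. \<forall>a\<in>A - B. \<exists>b\<in>B - A. insert b (A - {a}) \<in> \<B>)"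

(* All bases have the same cardinality, see matroid_rank_eq below. *)
definition matroid_rank :: "'a set set \<Rightarrow> nat" where
  "matroid_rank \<B> = Max (card ` \<B>)"

(* Labelled matroids: no identification up to isomorphism. *)
definition matroids :: "nat \<Rightarrow> nat set set set" where
  "matroids n = {\<B>. matroid {1..n} \<B>}"

definition matroid_fraction :: "(nat set set \<Rightarrow> bool) \<Rightarrow> nat \<Rightarrow> real" where
  "matroid_fraction P n =
     real (card {\<B> \<in> matroids n. P \<B>}) / real (card (matroids n))"

lemma matroid_bases_card_eq:
  assumes M: "matroid E \<B>" and "A \<in> \<B>" "B \<in> \<B>"
  shows "card A = card B"
  using assms(2)
proof (induction "card (A - B)" arbitrary: A rule: less_induct)
  case less
  have exch: "\<exists>b\<in>Y - X. insert b (X - {a}) \<in> \<B>"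
    if "X \<in> \<B>" "Y \<in> \<B>" "a \<in> X - Y" for X Y a
    using M that unfolding matroid_def by blast
  have "A \<subseteq> E" "finite E" using M less.prems unfolding matroid_def by auto
  then have fin: "finite A" using finite_subset by blast
  show ?case
  proof (cases "A - B = {}")
    case True
    then have "B - A = {}" using exch[OF assms(3) less.prems] by blast
    with True show ?thesis by (simp add: subset_antisym)
  next
    case False
    then obtain a where a: "a \<in> A - B" by blast
    then obtain b where b: "b \<in> B - A" and new: "insert b (A - {a}) \<in> \<B>"
      using exch[OF less.prems assms(3)] by blast
    have "insert b (A - {a}) - B = (A - B) - {a}" using b by auto
    then have "card (insert b (A - {a}) - B) < card (A - B)"
      using card_Diff1_less[of "A - B" a] fin a by simp
    from less.hyps[OF this new] have "card (insert b (A - {a})) = card B" .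
    moreover have "card (insert b (A - {a})) = card A"
      using a b fin card_Suc_Diff1[of A a] by simp
    ultimately show ?thesis by simp
  qed
qed

lemma matroid_rank_eq:
  assumes "matroid E \<B>" "B \<in> \<B>"
  shows "matroid_rank \<B> = card B"
proof -
  have "card ` \<B> = {card B}"
  proof (intro equalityI subsetI)
    fix k assume "k \<in> card ` \<B>"
    then obtain A where "A \<in> \<B>" "k = card A" by blast
    then show "k \<in> {card B}"
      using matroid_bases_card_eq[OF assms(1) \<open>A \<in> \<B>\<close> assms(2)] by simp
  next
    fix k assume "k \<in> {card B}"
    then show "k \<in> card ` \<B>" using assms(2) by simp
  qed
  then show ?thesis by (simp add: matroid_rank_def)
qed

lemma finite_matroids: "finite (matroids n)"
  by (rule finite_subset[of _ "Pow (Pow {1..n})"]) (auto simp: matroids_def matroid_def)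

lemma card_matroids_pos: "card (matroids n) > 0"
proof -
  have "{{}} \<in> matroids n" by (simp add: matroids_def matroid_def)
  then show ?thesis using finite_matroids card_gt_0_iff by blast
qed

end

theory Submission
  imports Defs "HOL-Real_Asymp.Real_Asymp"
begin

text \<open>
  Write $N_r = {n \choose r}$. The $r$-sets with a fixed element sum modulo $n$ are pairwise
  non-adjacent in the Johnson graph, so every subset of the largest such class is the set of
  non-bases of a (sparse paving) matroid; this gives at least $2^{N_{n/2}/n}$ matroids. Since
  $N_r$ drops by an arbitrarily large constant factor at distance $\beta\sqrt n$ from $n/2$, it is
  enough to bound the number of matroids of rank $r \in [n/4, 3n/4]$ by $2^{O(N_r/n)}$, without a
  logarithmic loss.

  For this, the set of non-bases is encoded by the graph container method in the Johnson graph: a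
  non-basis $X$ of maximal degree determines the status of all its neighbours $X - x + y$ through
  the set of $x$ with $X - x$ dependent and the set of $y$ in the closure of $X$. There are about
  $N_r \log n / n^2$ such $X$, so this is affordable only if these two sets have size
  $n^{1-\varepsilon}$. If one of them is larger, $X$ lies in a hyperplane with at least $r + t$ elements
  (or, dually, contains a circuit of size at most $r - t$). Unless some set of size $e$ has tiny rank,
  in which case almost all $r$-sets are non-bases and there are few such matroids, each such
  hyperplane has so many bases that all of them can be listed at negligible cost.
\<close>

section \<open>Independence and large hyperplanes\<close>

text \<open>Both bounds have exponents of order N_r/n, so the comparison rests on constants: 10
  N_r/n above in the middle range, N_{n/2}/n below. At distance 10 sqrt n the binomial has dropped
  by a factor of at least 40, which turns 10 into 1/4; this is the origin of \<beta>_0 = 10. A lost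
  factor log n would allow only windows of order sqrt (n log log n). The number N_r log n / n^2 of
  recorded non-bases arises as follows. In a set of more than about N_r/n vertices some vertex is
  adjacent to a \<delta>-fraction of the set, with \<delta> of order n^2/N_r, and shrinking from N_r
  to N_r/n takes (log n)/\<delta> such steps. The last O(N_r/n) vertices are decided arbitrarily,
  which is the dominant cost. The encoding records non-bases because the bases among the neighbours
  of a non-basis form a combinatorial rectangle, which two sets of elements describe. Ranks outside
  [n/4, 3n/4] need none of this: there N_r is exponentially smaller than N_{n/2}, and the trivial
  bound 2^{N_r} suffices.\<close>

definition ksets :: "'a set \<Rightarrow> nat \<Rightarrow> 'a set set" where
  "ksets E r = {X. X \<subseteq> E \<and> card X = r}"

lemma finite_ksets [simp]: "finite E \<Longrightarrow> finite (ksets E r)"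
  by (rule finite_subset[of _ "Pow E"]) (auto simp: ksets_def)

lemma card_ksets: "finite E \<Longrightarrow> card (ksets E r) = card E choose r"
  unfolding ksets_def by (rule n_subsets)

definition indep :: "'a set set \<Rightarrow> 'a set \<Rightarrow> bool" where
  "indep \<B> I \<longleftrightarrow> (\<exists>B\<in>\<B>. I \<subseteq> B)"

text \<open>The closure of \<open>I\<close> when \<open>I\<close> is independent. For a dependent
  \<open>I\<close> the formula yields all of \<open>E\<close>, so closures are taken of independent
  sets only.\<close>

definition mspan :: "'a set \<Rightarrow> 'a set set \<Rightarrow> 'a set \<Rightarrow> 'a set" where
  "mspan E \<B> I = {y \<in> E. y \<in> I \<or> \<not> indep \<B> (insert y I)}"

lemma mspan_subset: "mspan E \<B> I \<subseteq> E"
  by (auto simp: mspan_def)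

lemma matroid_finite: "matroid E \<B> \<Longrightarrow> finite E"
  by (simp add: matroid_def)

lemma indep_ground: "matroid E \<B> \<Longrightarrow> indep \<B> I \<Longrightarrow> I \<subseteq> E"
  by (auto simp: matroid_def indep_def)

lemma indep_finite: "matroid E \<B> \<Longrightarrow> indep \<B> I \<Longrightarrow> finite I"
  using indep_ground matroid_finite finite_subset by metis

section \<open>Augmentation and closure from basis exchange\<close>

lemma matroid_exchange:
  assumes "matroid E \<B>" "A \<in> \<B>" "B \<in> \<B>" "a \<in> A - B"
  obtains b where "b \<in> B - A" "insert b (A - {a}) \<in> \<B>"
proof -
  have "\<forall>A\<in>\<B>. \<forall>B\<in>\<B>. \<forall>a\<in>A - B. \<exists>b\<in>B - A. insert b (A - {a}) \<in> \<B>"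
    using assms(1) by (simp add: matroid_def)
  then have "\<exists>b\<in>B - A. insert b (A - {a}) \<in> \<B>" using assms(2-4) by simp
  then show thesis using that by blast
qed

text \<open>Among the bases containing \<open>I\<close>, one with fewest elements outside
  \<open>B2 \<union> I\<close> lies inside \<open>I \<union> B2\<close>, as an exchange with
  \<open>B2\<close> would otherwise improve it. If no element of \<open>J\<close> augments
  \<open>I\<close>, this basis \<open>B1\<close> avoids \<open>J - I\<close>, so \<open>J\<close>
  and \<open>B1 - I\<close> are disjoint subsets of \<open>B2\<close>, too large for a set of the
  size of \<open>B1\<close>.\<close>

lemma augment:
  assumes M: "matroid E \<B>" and I: "indep \<B> I" and J: "indep \<B> J" and lt: "card I < card J"
  shows "\<exists>x\<in>J - I. indep \<B> (insert x I)"
proof (rule ccontr)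
  assume "\<not> (\<exists>x\<in>J - I. indep \<B> (insert x I))"
  then have no: "\<not> indep \<B> (insert x I)" if "x \<in> J - I" for x
    using that by blast
  obtain B2 where B2: "B2 \<in> \<B>" "J \<subseteq> B2" using J by (auto simp: indep_def)
  obtain B0 where B0: "B0 \<in> \<B>" "I \<subseteq> B0" using I by (auto simp: indep_def)
  define P where "P = (\<lambda>B. B \<in> \<B> \<and> I \<subseteq> B)"
  define f where "f = (\<lambda>B. card (B - (B2 \<union> I)))"
  obtain B1 where B1: "P B1" and min: "\<And>B. P B \<Longrightarrow> f B1 \<le> f B"
    using ex_has_least_nat[of P B0 f] B0 by (auto simp: P_def)
  have fin: "finite B" if "B \<in> \<B>" for B
    using indep_finite[OF M, of B] that by (auto simp: indep_def)
  have B1': "B1 \<in> \<B>" "I \<subseteq> B1" using B1 by (auto simp: P_def)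
  have sub: "B1 \<subseteq> I \<union> B2"
  proof (rule ccontr)
    assume "\<not> B1 \<subseteq> I \<union> B2"
    then obtain b where b: "b \<in> B1" "b \<notin> I" "b \<notin> B2" by auto
    then obtain y where y: "y \<in> B2 - B1" "insert y (B1 - {b}) \<in> \<B>"
      using matroid_exchange[OF M B1'(1) B2(1), of b] by blast
    have "P (insert y (B1 - {b}))" using y b B1' by (auto simp: P_def)
    then have le: "f B1 \<le> f (insert y (B1 - {b}))" using min by blast
    have "insert y (B1 - {b}) - (B2 \<union> I) \<subset> B1 - (B2 \<union> I)" using y b by auto
    then have "f (insert y (B1 - {b})) < f B1"
      unfolding f_def using fin[OF B1'(1)] by (intro psubset_card_mono) auto
    with le show False by simp
  qed
  have disj: "B1 \<inter> (J - I) = {}"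
  proof (rule ccontr)
    assume "B1 \<inter> (J - I) \<noteq> {}"
    then obtain x where "x \<in> J - I" "insert x I \<subseteq> B1" using B1' by blast
    then show False using no B1' by (auto simp: indep_def)
  qed
  have "J \<union> (B1 - I) \<subseteq> B2" using sub B2 by auto
  then have "card (J \<union> (B1 - I)) \<le> card B2" using fin[OF B2(1)] by (intro card_mono)
  moreover have "card (J \<union> (B1 - I)) = card J + card (B1 - I)"
    using disj fin[OF B1'(1)] indep_finite[OF M J] by (intro card_Un_disjoint) auto
  moreover have "card (B1 - I) = card B1 - card I"
    using B1'(2) fin[OF B1'(1)] by (meson card_Diff_subset finite_subset)
  moreover have "card B1 = card B2" using matroid_bases_card_eq[OF M B1'(1) B2(1)] .
  moreover have "card I \<le> card B1" using B1'(2) fin[OF B1'(1)] by (intro card_mono)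
  ultimately show False using lt by linarith
qed

lemma augment_upto:
  assumes M: "matroid E \<B>" and I: "indep \<B> I" and J: "indep \<B> J" and le: "card I \<le> card J"
  obtains I' where "I \<subseteq> I'" "I' \<subseteq> I \<union> J" "indep \<B> I'" "card I' = card J"
proof -
  have "\<exists>I'. I \<subseteq> I' \<and> I' \<subseteq> I \<union> J \<and> indep \<B> I' \<and> card I' = card J"
    using I le
  proof (induction "card J - card I" arbitrary: I)
    case 0
    then show ?case by (intro exI[of _ I]) auto
  next
    case (Suc d)
    then have "card I < card J" by linarith
    then obtain x where x: "x \<in> J - I" "indep \<B> (insert x I)"
      using augment[OF M Suc.prems(1) J] by blast
    have c: "card (insert x I) = Suc (card I)"
      using x(1) indep_finite[OF M Suc.prems(1)] by simp
    have "\<exists>I'. insert x I \<subseteq> I' \<and> I' \<subseteq> insert x I \<union> J \<and> indep \<B> I' \<and> card I' = card J"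
      using Suc.hyps(2) c by (intro Suc.hyps(1) x) auto
    then show ?case using x(1) by blast
  qed
  then show ?thesis using that by blast
qed

lemma indep_in_mspan_card_le:
  assumes M: "matroid E \<B>" and I: "indep \<B> I" and J: "indep \<B> J" "J \<subseteq> mspan E \<B> I"
  shows "card J \<le> card I"
proof (rule ccontr)
  assume "\<not> card J \<le> card I"
  then obtain x where "x \<in> J - I" "indep \<B> (insert x I)"
    using augment[OF M I J(1)] by auto
  then show False using J(2) by (auto simp: mspan_def)
qed

text \<open>A hyperplane is thus determined by any of its bases; this makes the families of bases of
  distinct hyperplanes disjoint in \<open>card_big_hyps\<close>.\<close>

lemma mspan_eq:
  assumes M: "matroid E \<B>" and I: "indep \<B> I" and J: "indep \<B> J" "J \<subseteq> mspan E \<B> I"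
    and c: "card J = card I"
  shows "mspan E \<B> J = mspan E \<B> I"
proof (intro equalityI subsetI)
  fix y assume y: "y \<in> mspan E \<B> I"
  show "y \<in> mspan E \<B> J"
  proof (rule ccontr)
    assume "y \<notin> mspan E \<B> J"
    then have "y \<notin> J" "indep \<B> (insert y J)" using y by (auto simp: mspan_def)
    then show False
      using indep_in_mspan_card_le[OF M I, of "insert y J"] y J c indep_finite[OF M J(1)] by simp
  qed
next
  fix y assume y: "y \<in> mspan E \<B> J"
  show "y \<in> mspan E \<B> I"
  proof (rule ccontr)
    assume "y \<notin> mspan E \<B> I"
    then have y': "y \<notin> I" "indep \<B> (insert y I)" "y \<notin> J"
      using y J(2) by (auto simp: mspan_def)
    then have "card J < card (insert y I)" using c indep_finite[OF M I] by simp
    then obtain x where x: "x \<in> insert y I - J" "indep \<B> (insert x J)"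
      using augment[OF M J(1) y'(2)] by blast
    have "x \<noteq> y" using x(2) y y'(3) by (auto simp: mspan_def)
    then have "x \<in> I" "x \<notin> J" using x(1) by auto
    then have "insert x J \<subseteq> mspan E \<B> I" "card (insert x J) = Suc (card I)"
      using J c indep_finite[OF M J(1)] indep_ground[OF M I] by (auto simp: mspan_def)
    then show False using indep_in_mspan_card_le[OF M I x(2)] by simp
  qed
qed

section \<open>Flats of small rank and large hyperplanes\<close>

text \<open>The dividing line between the two cases: without a crowded flat of rank below
  \<open>k\<close>, large hyperplanes have many bases; with one, the matroid has few bases.\<close>

definition thin :: "'a set \<Rightarrow> 'a set set \<Rightarrow> nat \<Rightarrow> nat \<Rightarrow> bool" where
  "thin E \<B> k e \<longleftrightarrow> (\<forall>J. indep \<B> J \<and> card J < k \<longrightarrow> card (mspan E \<B> J) \<le> e)"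

definition big_hyps :: "'a set \<Rightarrow> 'a set set \<Rightarrow> nat \<Rightarrow> nat \<Rightarrow> 'a set set" where
  "big_hyps E \<B> r t = {mspan E \<B> I | I. indep \<B> I \<and> Suc (card I) = r \<and> card (mspan E \<B> I) \<ge> r + t}"

lemma big_hyps_subset: "big_hyps E \<B> r t \<subseteq> Pow E"
  using mspan_subset by (fastforce simp: big_hyps_def)

lemma subset_big_hyp_nonbasis:
  assumes M: "matroid E \<B>" and H: "H \<in> big_hyps E \<B> r t" and X: "X \<subseteq> H" "card X = r"
  shows "X \<notin> \<B>"
proof
  assume "X \<in> \<B>"
  obtain I where I: "H = mspan E \<B> I" "indep \<B> I" "Suc (card I) = r"
    using H by (auto simp: big_hyps_def)
  have "indep \<B> X" using \<open>X \<in> \<B>\<close> by (auto simp: indep_def)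
  then show False using indep_in_mspan_card_le[OF M I(2)] I X by force
qed

text \<open>Double counting of the pairs (\<open>insert y J\<close>, \<open>y\<close>): every
  \<open>J\<close> yields at least \<open>m\<close> of them, and a set of size \<open>Suc j\<close>
  occurs in at most \<open>Suc j\<close>.\<close>

lemma card_image_insert_le:
  assumes finS: "finite S" and S: "\<And>J. J \<in> S \<Longrightarrow> finite J \<and> card J = j"
    and Y: "\<And>J. J \<in> S \<Longrightarrow> finite (Y J) \<and> Y J \<inter> J = {} \<and> m \<le> card (Y J)"
    and T: "\<And>J y. J \<in> S \<Longrightarrow> y \<in> Y J \<Longrightarrow> insert y J \<in> T" "finite T"
  shows "m * card S \<le> Suc j * card T"
proof -
  have "m * card S = (\<Sum>J\<in>S. m)" by simp
  also have "\<dots> \<le> (\<Sum>J\<in>S. card (Y J))" using Y by (intro sum_mono) auto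
  also have "\<dots> = card (Sigma S Y)" using Y finS by simp
  also have "\<dots> \<le> card (Sigma {L \<in> T. finite L \<and> card L = Suc j} (\<lambda>L. L))"
  proof (rule card_inj_on_le[where f="\<lambda>(J,y). (insert y J, y)"])
    show "inj_on (\<lambda>(J, y). (insert y J, y)) (Sigma S Y)"
    proof (rule inj_onI)
      fix p p' assume a: "p \<in> Sigma S Y" "p' \<in> Sigma S Y"
        "(case p of (J, y) \<Rightarrow> (insert y J, y)) = (case p' of (J, y) \<Rightarrow> (insert y J, y))"
      obtain J y J' y' where p: "p = (J, y)" "p' = (J', y')" by fastforce
      have "y \<notin> J" "y' \<notin> J'" using Y[of J] Y[of J'] a(1,2) p by auto
      with a(3) p show "p = p'" by (auto simp: insert_ident)
    qed
    show "(\<lambda>(J, y). (insert y J, y)) ` Sigma S Y \<subseteq> Sigma {L \<in> T. finite L \<and> card L = Suc j} (\<lambda>L. L)"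
    proof clarify
      fix J y assume a: "J \<in> S" "y \<in> Y J"
      then have "y \<notin> J" using Y[of J] by blast
      then show "insert y J \<in> {L \<in> T. finite L \<and> card L = Suc j} \<and> y \<in> insert y J"
        using S[OF a(1)] T(1)[OF a] by simp
    qed
    show "finite (Sigma {L \<in> T. finite L \<and> card L = Suc j} (\<lambda>L. L))" using T(2) by auto
  qed
  also have "\<dots> = (\<Sum>L\<in>{L \<in> T. finite L \<and> card L = Suc j}. card L)" using T(2) by simp
  also have "\<dots> = card {L \<in> T. finite L \<and> card L = Suc j} * Suc j" by simp
  also have "\<dots> \<le> card T * Suc j" using T(2) by (intro mult_right_mono card_mono) auto
  finally show ?thesis by (simp add: mult.commute)
qed

text \<open>Every independent set of size $j < k$ in the hyperplane has at least $m$ one-element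
  extensions inside it, and each independent $k$-set extends to a basis of the hyperplane.\<close>

lemma big_hyp_bases:
  assumes M: "matroid E \<B>" and thin: "thin E \<B> k e" and I: "indep \<B> I" "k \<le> card I"
    and m: "m + e \<le> card (mspan E \<B> I)"
  shows "m ^ k \<le> card I ^ k * card {J. indep \<B> J \<and> J \<subseteq> mspan E \<B> I \<and> card J = card I}"
proof -
  let ?F = "mspan E \<B> I"
  define S where "S = (\<lambda>j. {J. indep \<B> J \<and> J \<subseteq> ?F \<and> card J = j})"
  have finF: "finite ?F" using mspan_subset matroid_finite[OF M] finite_subset by metis
  have finS: "finite (S j)" for j
    by (rule finite_subset[of _ "Pow ?F"]) (auto simp: S_def finF)
  \<comment> \<open>Adding one element at a time produces at least m^j ordered independent j-tuples
    inside the hyperplane, and a j-set has \<open>fact j\<close> orderings.\<close>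
  have "m ^ j \<le> fact j * card (S j)" if "j \<le> k" for j
    using that
  proof (induction j)
    case 0
    have "{} \<in> S 0" using I by (auto simp: S_def indep_def)
    then have "card (S 0) > 0" using finS card_gt_0_iff by blast
    then show ?case by simp
  next
    case (Suc j)
    have "m * card (S j) \<le> Suc j * card (S (Suc j))"
    proof (rule card_image_insert_le[where Y="\<lambda>J. ?F - mspan E \<B> J"])
      fix J assume J: "J \<in> S j"
      then have Ji: "indep \<B> J" "card J < k" "J \<subseteq> ?F" using Suc.prems by (auto simp: S_def)
      show "finite J \<and> card J = j" using J indep_finite[OF M] by (auto simp: S_def)
      have "J \<subseteq> mspan E \<B> J" using Ji(1) indep_ground[OF M] by (auto simp: mspan_def)
      moreover have "m \<le> card (?F - mspan E \<B> J)"
      proof -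
        have "card (mspan E \<B> J) \<le> e" using thin Ji by (auto simp: thin_def)
        moreover have "card ?F - card (mspan E \<B> J) \<le> card (?F - mspan E \<B> J)"
          using diff_card_le_card_Diff finite_subset[OF mspan_subset matroid_finite[OF M]] by blast
        ultimately show ?thesis using m by linarith
      qed
      ultimately show "finite (?F - mspan E \<B> J) \<and> (?F - mspan E \<B> J) \<inter> J = {}
          \<and> m \<le> card (?F - mspan E \<B> J)"
        using finF by auto
      fix y assume y: "y \<in> ?F - mspan E \<B> J"
      then have "y \<in> E" "y \<notin> J" "indep \<B> (insert y J)" using mspan_subset by (auto simp: mspan_def)
      then show "insert y J \<in> S (Suc j)" using y J indep_finite[OF M Ji(1)] by (auto simp: S_def)
    qed (use finS in auto)
    then have "fact j * (m * card (S j)) \<le> fact j * (Suc j * card (S (Suc j)))"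
      by (rule mult_le_mono2)
    moreover have "m * m ^ j \<le> m * (fact j * card (S j))"
      using Suc by (intro mult_le_mono2) simp
    ultimately have "m * m ^ j \<le> fact j * (Suc j * card (S (Suc j)))"
      by (simp only: mult.left_commute[of m])
    then show ?case by (simp add: algebra_simps)
  qed
  then have "m ^ k \<le> fact k * card (S k)" by simp
  also have "card (S k) \<le> card (Sigma (S (card I)) (\<lambda>J. ksets J k))"
  proof -
    have "S k \<subseteq> snd ` Sigma (S (card I)) (\<lambda>J. ksets J k)"
    proof
      fix J assume J: "J \<in> S k"
      then have "indep \<B> J" "card J \<le> card I" using I by (auto simp: S_def)
      then obtain I' where I': "J \<subseteq> I'" "I' \<subseteq> J \<union> I" "indep \<B> I'" "card I' = card I"
        using augment_upto[OF M _ I(1)] by blast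
      have "I \<subseteq> ?F" using I indep_ground[OF M] by (auto simp: mspan_def)
      then have "(I', J) \<in> Sigma (S (card I)) (\<lambda>J. ksets J k)"
        using I' J by (auto simp: S_def ksets_def)
      then show "J \<in> snd ` Sigma (S (card I)) (\<lambda>J. ksets J k)" by force
    qed
    moreover have "finite (Sigma (S (card I)) (\<lambda>J. ksets J k))"
    proof (rule finite_SigmaI[OF finS])
      fix J assume "J \<in> S (card I)"
      then have "finite J" using indep_finite[OF M] by (auto simp: S_def)
      then show "finite (ksets J k)" by simp
    qed
    ultimately show ?thesis by (rule surj_card_le[rotated])
  qed
  also have "card (Sigma (S (card I)) (\<lambda>J. ksets J k)) = card (S (card I)) * (card I choose k)"
  proof -
    have f: "finite J" if "J \<in> S (card I)" for J using that indep_finite[OF M] by (auto simp: S_def)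
    have "card (Sigma (S (card I)) (\<lambda>J. ksets J k)) = (\<Sum>J\<in>S (card I). card (ksets J k))"
      using f finS by (intro card_SigmaI) auto
    also have "\<dots> = (\<Sum>J\<in>S (card I). card I choose k)"
    proof (intro sum.cong refl)
      fix J assume J: "J \<in> S (card I)"
      show "card (ksets J k) = card I choose k" using card_ksets[OF f[OF J]] J by (simp add: S_def)
    qed
    finally show ?thesis by simp
  qed
  \<comment> \<open>The factorial from the orderings cancels against the binomial coefficient, so
    the full quotient (m / card I)^k survives.\<close>
  also have "fact k * (card (S (card I)) * (card I choose k)) \<le> card I ^ k * card (S (card I))"
  proof -
    have "(card I choose k) * fact k \<le> card I ^ k"
      using binomial_fact_pow by blast
    then have "(card I choose k) * fact k * card (S (card I)) \<le> card I ^ k * card (S (card I))"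
      by (rule mult_le_mono1)
    then show ?thesis by (simp only: mult_ac)
  qed
  finally show ?thesis by (simp add: S_def)
qed

text \<open>The bases of distinct hyperplanes form disjoint families of (r-1)-sets, and by
  \<open>big_hyp_bases\<close> each large hyperplane claims at least ((r + t - e) / r)^k of
  them.\<close>

lemma card_big_hyps:
  assumes M: "matroid E \<B>" and thin: "thin E \<B> k e" and k: "k < r" and t: "e \<le> t"
  shows "card (big_hyps E \<B> r t) * (r + t - e) ^ k \<le> r ^ k * (card E choose (r - 1))"
proof -
  let ?H = "big_hyps E \<B> r t"
  define U where "U = (\<lambda>F. {J. indep \<B> J \<and> J \<subseteq> F \<and> card J = r - 1})"
  have finE: "finite E" using M matroid_finite by auto
  have finH: "finite ?H" using big_hyps_subset finE by (meson finite_Pow_iff finite_subset)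
  have F: "\<exists>I. F = mspan E \<B> I \<and> indep \<B> I \<and> card I = r - 1 \<and> r + t \<le> card F" if "F \<in> ?H" for F
    using that by (auto simp: big_hyps_def)
  have U: "(r + t - e) ^ k \<le> r ^ k * card (U F)" if FH: "F \<in> ?H" for F
  proof -
    obtain I where I: "F = mspan E \<B> I" "indep \<B> I" "card I = r - 1" "r + t \<le> card F"
      using F[OF FH] by blast
    have "(r + t - e) ^ k \<le> card I ^ k * card (U F)"
      using big_hyp_bases[OF M thin I(2), of "r + t - e"] I k t by (simp add: U_def)
    also have "\<dots> \<le> r ^ k * card (U F)" using I by (intro mult_right_mono power_mono) auto
    finally show ?thesis .
  qed
  have US: "U F \<subseteq> ksets E (r - 1)" for F using indep_ground[OF M] by (auto simp: U_def ksets_def)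
  have finU: "finite (U F)" for F using US finE finite_ksets finite_subset by metis
  have "card ?H * (r + t - e) ^ k = (\<Sum>F\<in>?H. (r + t - e) ^ k)" by simp
  also have "\<dots> \<le> (\<Sum>F\<in>?H. r ^ k * card (U F))" by (intro sum_mono U)
  also have "\<dots> = r ^ k * (\<Sum>F\<in>?H. card (U F))" by (simp add: sum_distrib_left)
  also have "(\<Sum>F\<in>?H. card (U F)) = card (\<Union>F\<in>?H. U F)"
  proof (rule card_UN_disjoint[symmetric])
    show "\<forall>F\<in>?H. \<forall>F'\<in>?H. F \<noteq> F' \<longrightarrow> U F \<inter> U F' = {}"
    proof (intro ballI impI, rule ccontr)
      fix F F' assume a: "F \<in> ?H" "F' \<in> ?H" "F \<noteq> F'" "U F \<inter> U F' \<noteq> {}"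
      then obtain J where J: "J \<in> U F" "J \<in> U F'" by auto
      have *: "mspan E \<B> J = G" if G: "G \<in> ?H" "J \<in> U G" for G
      proof -
        obtain I where I: "G = mspan E \<B> I" "indep \<B> I" "card I = r - 1"
          using F[OF G(1)] by blast
        then show ?thesis using mspan_eq[OF M I(2), of J] G by (auto simp: U_def)
      qed
      show False using *[OF a(1) J(1)] *[OF a(2) J(2)] a(3) by simp
    qed
  qed (use finH finU in auto)
  also have "\<dots> \<le> card (ksets E (r - 1))" using US finE by (intro card_mono) auto
  also have "\<dots> = card E choose (r - 1)" using card_ksets[OF finE] .
  finally show ?thesis by simp
qed

section \<open>Containers in the Johnson graph\<close>

text \<open>Pascal's rule in the shape of the branching in \<open>container_count\<close>: one
  branch keeps the budget \<open>q\<close>, the other pays a factor \<open>g\<close> and one unit of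
  budget.\<close>

lemma binomial_weight_Suc:
  fixes g :: real
  shows "(\<Sum>s\<le>Suc q. real (Suc m choose s) * g ^ s)
    = (\<Sum>s\<le>Suc q. real (m choose s) * g ^ s) + g * (\<Sum>s\<le>q. real (m choose s) * g ^ s)"
proof -
  have "(\<Sum>s\<le>Suc q. real (Suc m choose s) * g ^ s)
      = 1 + (\<Sum>s\<le>q. real (Suc m choose Suc s) * g ^ Suc s)"
    by (simp add: sum.atMost_Suc_shift del: sum.atMost_Suc)
  also have "\<dots> = 1 + ((\<Sum>s\<le>q. real (m choose Suc s) * g ^ Suc s)
      + (\<Sum>s\<le>q. real (m choose s) * g ^ Suc s))"
    by (simp add: algebra_simps sum.distrib)
  also have "(\<Sum>s\<le>q. real (m choose s) * g ^ Suc s) = g * (\<Sum>s\<le>q. real (m choose s) * g ^ s)"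
    by (simp add: sum_distrib_left algebra_simps)
  also have "1 + ((\<Sum>s\<le>q. real (m choose Suc s) * g ^ Suc s)
      + g * (\<Sum>s\<le>q. real (m choose s) * g ^ s))
      = (\<Sum>s\<le>Suc q. real (m choose s) * g ^ s) + g * (\<Sum>s\<le>q. real (m choose s) * g ^ s)"
    by (simp add: sum.atMost_Suc_shift del: sum.atMost_Suc)
  finally show ?thesis .
qed

text \<open>Kleitman--Winston: branch on whether a vertex $v$ of maximal degree lies in \<open>nb M\<close>. If it does,
  the information attached to $v$ settles $v$ and all its neighbours, which are a $\delta$-fraction
  of $A$, so this happens at most $q$ times before at most $a$ vertices remain.\<close>

lemma container_count:
  fixes nb :: "'m \<Rightarrow> 'v set" and info :: "'m \<Rightarrow> 'v \<Rightarrow> 'i" and adj :: "'v \<Rightarrow> 'v set"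
    and a \<delta> :: real
  assumes \<delta>: "0 \<le> \<delta>" "\<delta> \<le> 1" and a: "0 \<le> a"
    and "finite A" "finite \<K>"
    and "\<And>M M'. M \<in> \<K> \<Longrightarrow> M' \<in> \<K> \<Longrightarrow> nb M \<inter> A = nb M' \<inter> A \<Longrightarrow> M = M'"
    and "\<And>v. v \<in> A \<Longrightarrow> finite (G v) \<and> card (G v) \<le> g"
    and "\<And>M v. M \<in> \<K> \<Longrightarrow> v \<in> A \<Longrightarrow> v \<in> nb M \<Longrightarrow> info M v \<in> G v"
    and "\<And>M M' v. M \<in> \<K> \<Longrightarrow> M' \<in> \<K> \<Longrightarrow> v \<in> A \<Longrightarrow> v \<in> nb M \<Longrightarrow> v \<in> nb M' \<Longrightarrow>
      info M v = info M' v \<Longrightarrow> adj v \<inter> A \<inter> nb M = adj v \<inter> A \<inter> nb M'"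
    and "\<And>A'. A' \<subseteq> A \<Longrightarrow> a < real (card A') \<Longrightarrow> \<exists>v\<in>A'. \<delta> * real (card A') \<le> real (card (adj v \<inter> A'))"
    and "real (card A) * (1 - \<delta>) ^ q \<le> a"
  shows "real (card \<K>) \<le> 2 powr a * (\<Sum>s\<le>q. real (card A choose s) * real g ^ s)"
  using assms(4-)
proof (induction "card A" arbitrary: A \<K> q rule: less_induct)
  case (less A \<K> q)
  note finA = less.prems(1) and finK = less.prems(2) and inj = less.prems(3)
    and G = less.prems(4) and info = less.prems(5) and loc = less.prems(6)
    and deg = less.prems(7) and q = less.prems(8)
  define S where "S = (\<lambda>m q. \<Sum>s\<le>q. real (m choose s) * real g ^ s)"
  have S1: "1 \<le> S m q" for m q
  proof -
    have "real (m choose 0) * real g ^ 0 \<le> S m q"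
      unfolding S_def by (rule member_le_sum) auto
    then show ?thesis by simp
  qed
  show ?case
  proof (cases "real (card A) \<le> a")
    case True
    have "inj_on (\<lambda>M. nb M \<inter> A) \<K>" using inj by (auto intro: inj_onI)
    then have "card \<K> \<le> card (Pow A)" using finA by (intro card_inj_on_le) auto
    then have "real (card \<K>) \<le> 2 ^ card A" using finA by (simp add: card_Pow)
    also have "\<dots> = 2 powr real (card A)" by (simp add: powr_realpow)
    also have "\<dots> \<le> 2 powr a" using True by simp
    also have "\<dots> \<le> 2 powr a * S (card A) q" using S1 by simp
    finally show ?thesis by (simp add: S_def)
  next
    case False
    then obtain v where v: "v \<in> A" "\<delta> * real (card A) \<le> real (card (adj v \<inter> A))"
      using deg[of A] by auto
    \<comment> \<open>For q = 0 the last hypothesis would read card A \<le> a.\<close>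
    obtain q' where q': "q = Suc q'" using q False by (cases q) auto
    obtain m where m: "card A = Suc m"
      using v(1) finA by (metis card_gt_0_iff emptyE gr0_implies_Suc)
    define A' where "A' = A - {v} - adj v"
    have cv: "card (A - {v}) = m" using v(1) finA m by simp
    have A'm: "card A' \<le> m" unfolding A'_def cv[symmetric] using finA by (intro card_mono) auto
    have A'\<delta>: "real (card A') \<le> (1 - \<delta>) * real (card A)"
    proof -
      have "card A' \<le> card (A - adj v \<inter> A)" unfolding A'_def using finA by (intro card_mono) auto
      also have "\<dots> = card A - card (adj v \<inter> A)" using finA by (intro card_Diff_subset) auto
      finally have "card A' + card (adj v \<inter> A) \<le> card A"
        using card_mono[OF finA, of "adj v \<inter> A"] by auto
      then have "real (card A') + real (card (adj v \<inter> A)) \<le> real (card A)"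
        by (simp only: of_nat_add[symmetric] of_nat_le_iff)
      then show ?thesis using v(2) by (simp add: algebra_simps)
    qed
    \<comment> \<open>In \<open>K0\<close> only the status of \<open>v\<close> becomes known and the
      budget stays. In \<open>K1 i\<close> one unit is spent, and since \<open>i\<close> fixes
      \<open>nb M\<close> on \<open>adj v \<inter> A\<close>, members are still distinguished by
      \<open>A'\<close> alone.\<close>
    define K0 where "K0 = {M \<in> \<K>. v \<notin> nb M}"
    define K1 where "K1 = (\<lambda>i. {M \<in> \<K>. v \<in> nb M \<and> info M v = i})"
    have "real (card K0) \<le> 2 powr a * (\<Sum>s\<le>q. real (card (A - {v}) choose s) * real g ^ s)"
    proof (rule less.hyps)
      show "card (A - {v}) < card A" using cv m by simp
      show "M = M'" if "M \<in> K0" "M' \<in> K0" "nb M \<inter> (A - {v}) = nb M' \<inter> (A - {v})" for M M'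
        using that by (intro inj) (auto simp: K0_def)
      show "adj w \<inter> (A - {v}) \<inter> nb M = adj w \<inter> (A - {v}) \<inter> nb M'"
        if "M \<in> K0" "M' \<in> K0" "w \<in> A - {v}" "w \<in> nb M" "w \<in> nb M'" "info M w = info M' w" for M M' w
        using loc[of M M' w] that by (auto simp: K0_def)
      show "real (card (A - {v})) * (1 - \<delta>) ^ q \<le> a"
        using q cv m \<delta> by (intro order_trans[OF mult_right_mono q]) auto
      show "\<exists>v\<in>A''. \<delta> * real (card A'') \<le> real (card (adj v \<inter> A''))"
        if "A'' \<subseteq> A - {v}" "a < real (card A'')" for A'' using deg[of A''] that by auto
    qed (use finA finK G info in \<open>auto simp: K0_def\<close>)
    then have b0: "real (card K0) \<le> 2 powr a * S m q" by (simp add: S_def cv)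
    have b1: "real (card (K1 i)) \<le> 2 powr a * S m q'" for i
    proof -
      have "real (card (K1 i)) \<le> 2 powr a * (\<Sum>s\<le>q'. real (card A' choose s) * real g ^ s)"
      proof (rule less.hyps)
        show "card A' < card A" using A'm m by simp
        show "M = M'" if "M \<in> K1 i" "M' \<in> K1 i" "nb M \<inter> A' = nb M' \<inter> A'" for M M'
        proof (rule inj)
          have "adj v \<inter> A \<inter> nb M = adj v \<inter> A \<inter> nb M'"
            using that v(1) by (intro loc) (auto simp: K1_def)
          then show "nb M \<inter> A = nb M' \<inter> A" using that by (auto simp: K1_def A'_def)
        qed (use that in \<open>auto simp: K1_def\<close>)
        show "adj w \<inter> A' \<inter> nb M = adj w \<inter> A' \<inter> nb M'"
          if "M \<in> K1 i" "M' \<in> K1 i" "w \<in> A'" "w \<in> nb M" "w \<in> nb M'" "info M w = info M' w" for M M' w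
          using loc[of M M' w] that by (auto simp: K1_def A'_def)
        have "real (card A') * (1 - \<delta>) ^ q' \<le> ((1 - \<delta>) * real (card A)) * (1 - \<delta>) ^ q'"
          using A'\<delta> \<delta> by (intro mult_right_mono) auto
        then show "real (card A') * (1 - \<delta>) ^ q' \<le> a" using q q' by (simp add: algebra_simps)
        show "\<exists>v\<in>A''. \<delta> * real (card A'') \<le> real (card (adj v \<inter> A''))"
          if "A'' \<subseteq> A'" "a < real (card A'')" for A'' using deg[of A''] that by (auto simp: A'_def)
      qed (use finA finK G info in \<open>auto simp: K1_def A'_def\<close>)
      also have "(\<Sum>s\<le>q'. real (card A' choose s) * real g ^ s) \<le> S m q'"
        unfolding S_def using A'm by (intro sum_mono mult_right_mono) (auto simp: binomial_right_mono)
      finally show ?thesis by simp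
    qed
    have "\<K> \<subseteq> K0 \<union> (\<Union>i\<in>G v. K1 i)" using info v(1) by (auto simp: K0_def K1_def)
    then have "card \<K> \<le> card (K0 \<union> (\<Union>i\<in>G v. K1 i))"
      using G[OF v(1)] finK by (intro card_mono) (auto simp: K0_def K1_def)
    also have "\<dots> \<le> card K0 + (\<Sum>i\<in>G v. card (K1 i))"
      using G[OF v(1)] by (intro order_trans[OF card_Un_le] add_left_mono card_UN_le) auto
    finally have "real (card \<K>) \<le> real (card K0) + (\<Sum>i\<in>G v. real (card (K1 i)))"
      by (simp only: of_nat_add[symmetric] of_nat_sum[symmetric] of_nat_le_iff)
    also have "(\<Sum>i\<in>G v. real (card (K1 i))) \<le> real (card (G v)) * (2 powr a * S m q')"
      using sum_bounded_above[of "G v" "\<lambda>i. real (card (K1 i))" "2 powr a * S m q'"] b1 by simp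
    also have "\<dots> \<le> real g * (2 powr a * S m q')"
      using G[OF v(1)] S1[of m q'] by (intro mult_right_mono) auto
    finally have "real (card \<K>) \<le> 2 powr a * (S m q + real g * S m q')"
      using b0 by (simp add: algebra_simps)
    also have "S m q + real g * S m q' = S (card A) q"
      unfolding S_def q' m by (rule binomial_weight_Suc[symmetric])
    finally show ?thesis by (simp add: S_def)
  qed
qed

definition nbrs :: "'a set \<Rightarrow> 'a set \<Rightarrow> 'a set set" where
  "nbrs E X = {insert y (X - {x}) | x y. x \<in> X \<and> y \<in> E - X}"

text \<open>The $r$-sets containing a fixed $(r-1)$-set form a clique, and each edge lies in exactly one
  of these cliques; convexity of their sizes gives the bound.\<close>

lemma johnson_degree:
  assumes finE: "finite E" and r: "1 \<le> r" and A: "A \<subseteq> ksets E r" "A \<noteq> {}"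
  shows "\<exists>v\<in>A. real r * (real r * real (card A) / real (card E choose (r - 1)) - 1)
    \<le> real (card (nbrs E v \<inter> A))"
proof (rule ccontr)
  define Z where "Z = ksets E (r - 1)"
  define c where "c = (\<lambda>z. real (card {u \<in> A. z \<subseteq> u}))"
  define D where "D = real r * (real r * real (card A) / real (card Z) - 1)"
  assume "\<not> ?thesis"
  then have small: "real (card (nbrs E v \<inter> A)) < D" if "v \<in> A" for v
    using that card_ksets[OF finE] by (auto simp: D_def Z_def not_le)
  have finA: "finite A" using A(1) finite_ksets[OF finE] finite_subset by metis
  have finZ: "finite Z" using finE by (simp add: Z_def)
  have fv: "finite v" "card v = r" "v \<subseteq> E" if "v \<in> A" for v
    using that A(1) finite_subset[OF _ finE] by (auto simp: ksets_def)
  \<comment> \<open>Incidences between vertices and cliques, listed by the vertex \<open>v\<close>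
    or by the clique \<open>z = v - {x}\<close>; \<open>x\<close> is recovered as the only element
    of \<open>v - z\<close>.\<close>
  have sum_swap: "(\<Sum>v\<in>A. \<Sum>x\<in>v. f (v - {x})) = (\<Sum>z\<in>Z. \<Sum>v\<in>{u \<in> A. z \<subseteq> u}. f z)"
    for f :: "'a set \<Rightarrow> real"
  proof -
    have "(\<Sum>v\<in>A. \<Sum>x\<in>v. f (v - {x})) = (\<Sum>(v, x)\<in>Sigma A (\<lambda>v. v). f (v - {x}))"
      using finA fv by (subst sum.Sigma) auto
    also have "\<dots> = (\<Sum>(z, v)\<in>Sigma Z (\<lambda>z. {u \<in> A. z \<subseteq> u}). f z)"
    proof (rule sum.reindex_bij_witness[where j="\<lambda>(v, x). (v - {x}, v)"
          and i="\<lambda>(z, v). (v, the_elem (v - z))"])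
      fix p assume "p \<in> Sigma A (\<lambda>v. v)"
      then obtain v x where p: "p = (v, x)" and vx: "v \<in> A" "x \<in> v" by auto
      then have "v - (v - {x}) = {x}" by auto
      then show "(case case p of (v, x) \<Rightarrow> (v - {x}, v) of (z, v) \<Rightarrow> (v, the_elem (v - z))) = p"
        using p by simp
      show "(case p of (v, x) \<Rightarrow> (v - {x}, v)) \<in> Sigma Z (\<lambda>z. {u \<in> A. z \<subseteq> u})"
        using p vx fv[OF vx(1)] r by (auto simp: Z_def ksets_def)
      show "(case case p of (v, x) \<Rightarrow> (v - {x}, v) of (z, v) \<Rightarrow> f z) = (case p of (v, x) \<Rightarrow> f (v - {x}))"
        using p by simp
    next
      fix p assume "p \<in> Sigma Z (\<lambda>z. {u \<in> A. z \<subseteq> u})"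
      then obtain z v where p: "p = (z, v)" and zv: "z \<in> Z" "v \<in> A" "z \<subseteq> v" by auto
      then have "card (v - z) = 1"
        using fv[OF zv(2)] r card_Diff_subset[of z v] finite_subset[of z v] by (auto simp: Z_def ksets_def)
      then obtain x where x: "v - z = {x}" by (auto simp: card_1_singleton_iff)
      then show "(case case p of (z, v) \<Rightarrow> (v, the_elem (v - z)) of (v, x) \<Rightarrow> (v - {x}, v)) = p"
        using p zv(3) by auto
      show "(case p of (z, v) \<Rightarrow> (v, the_elem (v - z))) \<in> Sigma A (\<lambda>v. v)" using p x zv by auto
    qed
    also have "\<dots> = (\<Sum>z\<in>Z. \<Sum>v\<in>{u \<in> A. z \<subseteq> u}. f z)"
      using finA finZ by (subst sum.Sigma) auto
    finally show ?thesis .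
  qed
  have degv: "(\<Sum>x\<in>v. c (v - {x}) - 1) \<le> real (card (nbrs E v \<inter> A))" if v: "v \<in> A" for v
  proof -
    let ?W = "\<lambda>x. {u \<in> A. v - {x} \<subseteq> u} - {v}"
    have "(\<Sum>x\<in>v. c (v - {x}) - 1) = (\<Sum>x\<in>v. real (card (?W x)))"
    proof (rule sum.cong[OF refl])
      fix x
      have "v \<in> {u \<in> A. v - {x} \<subseteq> u}" using v by auto
      then have "card {u \<in> A. v - {x} \<subseteq> u} = Suc (card (?W x))"
        using finA by (intro card.remove) auto
      then show "c (v - {x}) - 1 = real (card (?W x))" by (simp add: c_def)
    qed
    also have "\<dots> = real (\<Sum>x\<in>v. card (?W x))" by simp
    also have "(\<Sum>x\<in>v. card (?W x)) = card (\<Union>x\<in>v. ?W x)"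
    proof (rule card_UN_disjoint[symmetric])
      show "\<forall>x\<in>v. \<forall>x'\<in>v. x \<noteq> x' \<longrightarrow> ?W x \<inter> ?W x' = {}"
      proof (intro ballI impI equals0I)
        fix x x' u assume a: "x \<in> v" "x' \<in> v" "x \<noteq> x'" "u \<in> ?W x \<inter> ?W x'"
        then have "v \<subseteq> u" "u \<in> A" "u \<noteq> v" by auto
        then show False using fv[of u] fv[OF v] card_subset_eq[of u v] by auto
      qed
    qed (use finA fv[OF v] in auto)
    also have "\<dots> \<le> card (nbrs E v \<inter> A)"
    proof (rule card_mono)
      show "(\<Union>x\<in>v. ?W x) \<subseteq> nbrs E v \<inter> A"
      proof
        fix u assume "u \<in> (\<Union>x\<in>v. ?W x)"
        then obtain x where u: "x \<in> v" "u \<in> A" "v - {x} \<subseteq> u" "u \<noteq> v" by blast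
        then have "card (u - (v - {x})) = 1"
          using fv[OF u(2)] fv[OF v] r card_Diff_subset[of "v - {x}" u] by simp
        then obtain y where y: "u - (v - {x}) = {y}" by (auto simp: card_1_singleton_iff)
        then have uy: "u = insert y (v - {x})" using u(3) by auto
        have "y \<notin> v"
        proof
          assume "y \<in> v"
          then have "y = x" using y by auto
          then show False using uy u(1,4) by auto
        qed
        moreover have "y \<in> E" using uy fv[OF u(2)] by auto
        ultimately show "u \<in> nbrs E v \<inter> A" using uy u(1,2) by (auto simp: nbrs_def)
      qed
    qed (use finA in simp)
    finally show ?thesis by simp
  qed
  have sc: "(\<Sum>z\<in>Z. c z) = real r * real (card A)"
  proof -
    have "(\<Sum>z\<in>Z. c z) = (\<Sum>v\<in>A. \<Sum>x\<in>v. 1)"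
      using sum_swap[of "\<lambda>_. 1"] by (simp add: c_def)
    also have "\<dots> = (\<Sum>v\<in>A. real r)" using fv by (intro sum.cong) auto
    finally show ?thesis by simp
  qed
  have pos: "0 < card A" using finA A(2) by (simp add: card_gt_0_iff)
  have posZ: "0 < card Z"
  proof (rule ccontr)
    assume "\<not> 0 < card Z"
    then have "Z = {}" using finZ by simp
    then show False using sc pos r by simp
  qed
  \<comment> \<open>Cauchy--Schwarz. The degrees in \<open>A\<close> add up to at least the sum of c
    z (c z - 1) over \<open>Z\<close>, so their average is at least \<open>D\<close>.\<close>
  have "(real r * real (card A))\<^sup>2 \<le> (\<Sum>z\<in>Z. (c z)\<^sup>2) * real (card Z)"
    using sum_squared_le_sum_of_squares[of c Z] finZ sc by simp
  then have "(real r * real (card A))\<^sup>2 / real (card Z) \<le> (\<Sum>z\<in>Z. (c z)\<^sup>2)"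
    using posZ by (simp add: divide_le_eq)
  moreover have "real (card A) * D = (real r * real (card A))\<^sup>2 / real (card Z) - real r * real (card A)"
    by (simp add: D_def algebra_simps power2_eq_square)
  moreover have "(\<Sum>z\<in>Z. (c z)\<^sup>2) - real r * real (card A) = (\<Sum>z\<in>Z. \<Sum>v\<in>{u \<in> A. z \<subseteq> u}. c z - 1)"
    by (simp add: sc[symmetric] sum_subtractf[symmetric] c_def power2_eq_square algebra_simps)
  ultimately have "real (card A) * D \<le> (\<Sum>v\<in>A. \<Sum>x\<in>v. c (v - {x}) - 1)"
    using sum_swap[of "\<lambda>z. c z - 1"] by simp
  also have "\<dots> \<le> (\<Sum>v\<in>A. real (card (nbrs E v \<inter> A)))" by (intro sum_mono degv)
  also have "\<dots> < (\<Sum>v\<in>A. D)" using small finA A(2) by (intro sum_strict_mono) auto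
  finally show False by simp
qed

section \<open>Non-bases and their neighbours\<close>

lemma card_ksets_meet_less:
  assumes finE: "finite E" and G: "G \<subseteq> E" "card G = e"
  shows "card {X \<in> ksets E r. card (X \<inter> G) < k}
    \<le> (\<Sum>i<k. (e choose i) * ((card E - e) choose (r - i)))"
proof -
  have finG: "finite G" using G finE finite_subset by auto
  let ?S = "\<lambda>i. ksets G i \<times> ksets (E - G) (r - i)"
  have "card {X \<in> ksets E r. card (X \<inter> G) < k} \<le> card (\<Union>i<k. ?S i)"
  proof (rule card_inj_on_le[where f="\<lambda>X. (X \<inter> G, X - G)"])
    show "inj_on (\<lambda>X. (X \<inter> G, X - G)) {X \<in> ksets E r. card (X \<inter> G) < k}"
      by (rule inj_onI) (auto simp: Int_Diff_Un[symmetric])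
    show "(\<lambda>X. (X \<inter> G, X - G)) ` {X \<in> ksets E r. card (X \<inter> G) < k} \<subseteq> (\<Union>i<k. ?S i)"
    proof (rule image_subsetI)
      fix X assume "X \<in> {X \<in> ksets E r. card (X \<inter> G) < k}"
      then have X: "X \<in> ksets E r" "card (X \<inter> G) < k" by auto
      then have "finite X" using finE finite_subset by (auto simp: ksets_def)
      then have "card (X - G) = r - card (X \<inter> G)"
        using X by (simp add: ksets_def card_Diff_subset_Int)
      then show "(X \<inter> G, X - G) \<in> (\<Union>i<k. ?S i)" using X by (auto simp: ksets_def)
    qed
    show "finite (\<Union>i<k. ?S i)" using finE finG by auto
  qed
  also have "\<dots> \<le> (\<Sum>i<k. card (?S i))" by (intro card_UN_le) auto
  also have "\<dots> = (\<Sum>i<k. (e choose i) * ((card E - e) choose (r - i)))"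
    using finE finG G by (intro sum.cong refl) (simp add: card_cartesian_product card_ksets card_Diff_subset)
  finally show ?thesis .
qed

text \<open>Take \<open>G\<close> inside a crowded flat of rank below \<open>k\<close>; a basis
  meets it in an independent set.\<close>

lemma not_thin_small_meet:
  assumes M: "matroid E \<B>" and nt: "\<not> thin E \<B> k e"
  obtains G where "G \<subseteq> E" "card G = e" "\<And>X. X \<in> \<B> \<Longrightarrow> card (X \<inter> G) < k"
proof -
  obtain J where J: "indep \<B> J" "card J < k" "e < card (mspan E \<B> J)"
    using nt by (auto simp: thin_def not_le)
  obtain G where G: "G \<subseteq> mspan E \<B> J" "card G = e"
    using J(3) by (meson less_imp_le obtain_subset_with_card_n)
  have "card (X \<inter> G) < k" if X: "X \<in> \<B>" for X
  proof -
    have "indep \<B> (X \<inter> G)" using X by (auto simp: indep_def)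
    then have "card (X \<inter> G) \<le> card J" using indep_in_mspan_card_le[OF M J(1)] G(1) by blast
    then show ?thesis using J(2) by simp
  qed
  then show thesis using that G mspan_subset[of E \<B> J] by blast
qed

text \<open>The factor \<open>2 ^ card E\<close> pays for the choice of \<open>G\<close>; the bases
  are then an arbitrary family of r-sets with small intersection with \<open>G\<close>.\<close>

lemma card_not_thin:
  assumes finE: "finite E"
  shows "card {\<B>. matroid E \<B> \<and> \<B> \<subseteq> ksets E r \<and> \<not> thin E \<B> k e}
    \<le> 2 ^ card E * 2 ^ (\<Sum>i<k. (e choose i) * ((card E - e) choose (r - i)))"
proof -
  let ?T = "\<Sum>i<k. (e choose i) * ((card E - e) choose (r - i))"
  let ?U = "\<lambda>G. {X \<in> ksets E r. card (X \<inter> G) < k}"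
  have "{\<B>. matroid E \<B> \<and> \<B> \<subseteq> ksets E r \<and> \<not> thin E \<B> k e} \<subseteq> (\<Union>G\<in>ksets E e. Pow (?U G))"
  proof
    fix \<B> assume "\<B> \<in> {\<B>. matroid E \<B> \<and> \<B> \<subseteq> ksets E r \<and> \<not> thin E \<B> k e}"
    then have B: "matroid E \<B>" "\<B> \<subseteq> ksets E r" "\<not> thin E \<B> k e" by auto
    obtain G where G: "G \<subseteq> E" "card G = e" "\<And>X. X \<in> \<B> \<Longrightarrow> card (X \<inter> G) < k"
      using not_thin_small_meet[OF B(1,3)] by blast
    then have "\<B> \<subseteq> ?U G" using B(2) by auto
    moreover have "G \<in> ksets E e" using G(1,2) by (simp add: ksets_def)
    ultimately show "\<B> \<in> (\<Union>G\<in>ksets E e. Pow (?U G))" by blast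
  qed
  then have "card {\<B>. matroid E \<B> \<and> \<B> \<subseteq> ksets E r \<and> \<not> thin E \<B> k e}
      \<le> card (\<Union>G\<in>ksets E e. Pow (?U G))"
    using finE by (intro card_mono) auto
  also have "\<dots> \<le> (\<Sum>G\<in>ksets E e. card (Pow (?U G)))" using finE by (intro card_UN_le) auto
  also have "\<dots> \<le> (\<Sum>G\<in>ksets E e. 2 ^ ?T)"
  proof (rule sum_mono)
    fix G assume "G \<in> ksets E e"
    then have "card (?U G) \<le> ?T" using card_ksets_meet_less[OF finE] by (auto simp: ksets_def)
    then show "card (Pow (?U G)) \<le> 2 ^ ?T" using finE by (simp add: card_Pow)
  qed
  also have "\<dots> = card (ksets E e) * 2 ^ ?T" by simp
  also have "\<dots> \<le> 2 ^ card E * 2 ^ ?T"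
  proof (rule mult_right_mono)
    have "card (ksets E e) \<le> card (Pow E)" using finE by (intro card_mono) (auto simp: ksets_def)
    then show "card (ksets E e) \<le> 2 ^ card E" using finE by (simp add: card_Pow)
  qed simp
  finally show ?thesis .
qed

section \<open>Duality\<close>

definition dual :: "'a set \<Rightarrow> 'a set set \<Rightarrow> 'a set set" where
  "dual E \<B> = (\<lambda>B. E - B) ` \<B>"

lemma in_dual_iff:
  assumes B: "\<B> \<subseteq> Pow E" and X: "X \<subseteq> E"
  shows "X \<in> dual E \<B> \<longleftrightarrow> E - X \<in> \<B>"
proof
  assume "X \<in> dual E \<B>"
  then obtain B where "B \<in> \<B>" "X = E - B" by (auto simp: dual_def)
  moreover from this have "E - X = B" using B by auto
  ultimately show "E - X \<in> \<B>" by simp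
next
  assume "E - X \<in> \<B>"
  then have "E - (E - X) \<in> dual E \<B>" unfolding dual_def by (rule imageI)
  then show "X \<in> dual E \<B>" using X by (simp add: double_diff)
qed

lemma dual_dual:
  assumes B: "\<B> \<subseteq> Pow E"
  shows "dual E (dual E \<B>) = \<B>"
proof -
  have "dual E (dual E \<B>) = (\<lambda>B. E - (E - B)) ` \<B>" by (simp add: dual_def image_image)
  also have "\<dots> = (\<lambda>B. B) ` \<B>" using B by (intro image_cong) auto
  finally show ?thesis by simp
qed

lemma dual_ksets:
  assumes E: "finite E" and B: "\<B> \<subseteq> ksets E r"
  shows "dual E \<B> \<subseteq> ksets E (card E - r)"
proof
  fix X assume "X \<in> dual E \<B>"
  then obtain B where B': "B \<in> \<B>" "X = E - B" by (auto simp: dual_def)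
  then have "B \<subseteq> E" "card B = r" using B by (auto simp: ksets_def)
  then show "X \<in> ksets E (card E - r)"
    using B'(2) finite_subset[OF _ E] by (simp add: ksets_def card_Diff_subset)
qed

lemma full_indep_basis:
  assumes M: "matroid E \<B>" and I: "indep \<B> I" "card I = card B" "B \<in> \<B>"
  shows "I \<in> \<B>"
proof -
  obtain B' where B': "B' \<in> \<B>" "I \<subseteq> B'" using I(1) by (auto simp: indep_def)
  moreover have "finite B'" using indep_finite[OF M, of B'] B' by (auto simp: indep_def)
  moreover have "card B' = card I" using matroid_bases_card_eq[OF M B'(1) I(3)] I(2) by simp
  ultimately show ?thesis using card_subset_eq by metis
qed

text \<open>In terms of \<B>, dual exchange prescribes the incoming element: for \<open>a\<close> in
  \<open>B - A\<close> some \<open>b\<close> in \<open>A - B\<close> must make A - b + a a basis.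
  Extending \<open>insert a (A \<inter> B)\<close> to a basis by elements of \<open>A\<close> leaves
  out exactly one element of \<open>A\<close>, and that element is \<open>b\<close>.\<close>

lemma matroid_dual:
  assumes M: "matroid E \<B>"
  shows "matroid E (dual E \<B>)"
proof -
  have sub: "\<B> \<subseteq> Pow E" and ne: "\<B> \<noteq> {}" and finE: "finite E"
    using M by (auto simp: matroid_def)
  have "\<exists>b\<in>(E - B) - (E - A). insert b ((E - A) - {a}) \<in> dual E \<B>"
    if AB: "A \<in> \<B>" "B \<in> \<B>" "a \<in> (E - A) - (E - B)" for A B a
  proof -
    have fA: "finite A" "A \<subseteq> E" "B \<subseteq> E" using AB sub finE finite_subset by blast+
    have a: "a \<in> B" "a \<notin> A" "a \<in> E" using AB by auto
    let ?I = "insert a (A \<inter> B)"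
    have I: "indep \<B> ?I" "indep \<B> A" using AB a by (auto simp: indep_def)
    have "card ?I \<le> card B"
      using a fA finE finite_subset[of B E] by (intro card_mono) auto
    also have "card B = card A" using matroid_bases_card_eq[OF M AB(2,1)] .
    finally have "card ?I \<le> card A" .
    then obtain I' where I': "?I \<subseteq> I'" "I' \<subseteq> ?I \<union> A" "indep \<B> I'" "card I' = card A"
      using augment_upto[OF M I] by blast
    have "I' \<in> \<B>" using full_indep_basis[OF M I'(3,4) AB(1)] .
    have "card (A - I') = 1"
    proof -
      have "card (I' - {a}) = card A - 1" using I' a by simp
      moreover have "I' - {a} \<subseteq> A" using I'(2) by auto
      moreover have "A - I' = A - (I' - {a})" using a by auto
      moreover have "1 \<le> card A"
        using I'(1,4) fA finite_subset[OF I'(2)] by (metis One_nat_def Suc_leI card_gt_0_iff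
            finite_Int finite_Un finite_insert insert_not_empty subset_empty)
      ultimately show ?thesis using fA finite_subset[of "I' - {a}" A] by (simp add: card_Diff_subset)
    qed
    then obtain b where b: "A - I' = {b}" by (auto simp: card_1_singleton_iff)
    have "b \<in> A" "b \<notin> B" using b I'(1) by auto
    have I'eq: "I' = insert a (A - {b})" using b I'(1,2) by auto
    have "insert b ((E - A) - {a}) = E - I'" using I'eq \<open>b \<in> A\<close> fA a by auto
    then have "insert b ((E - A) - {a}) \<in> dual E \<B>" using \<open>I' \<in> \<B>\<close> by (auto simp: dual_def)
    then show ?thesis using \<open>b \<in> A\<close> \<open>b \<notin> B\<close> fA by auto
  qed
  then show ?thesis
    using sub ne finE unfolding matroid_def by (auto simp: dual_def)
qed

section \<open>The exchange matrix of a non-basis\<close>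

text \<open>The neighbours of \<open>X\<close> form a matrix with a row for each x in
  \<open>X\<close> and a column for each y outside. For a non-basis of rank r - 1, the bad columns
  are the elements of its closure outside \<open>X\<close>, and the bad rows are the x for which X -
  x is dependent.\<close>

definition bad_cols :: "'a set \<Rightarrow> 'a set set \<Rightarrow> 'a set \<Rightarrow> 'a set" where
  "bad_cols E \<B> X = {y \<in> E - X. \<forall>x\<in>X. insert y (X - {x}) \<notin> \<B>}"

definition bad_rows :: "'a set \<Rightarrow> 'a set set \<Rightarrow> 'a set \<Rightarrow> 'a set" where
  "bad_rows E \<B> X = {x \<in> X. \<forall>y\<in>E - X. insert y (X - {x}) \<notin> \<B>}"

text \<open>Duality transposes the matrix; every statement on rows follows from one on
  columns.\<close>

lemma bad_cols_dual:
  assumes "\<B> \<subseteq> Pow E" "X \<subseteq> E"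
  shows "bad_cols E (dual E \<B>) (E - X) = bad_rows E \<B> X"
proof -
  have "insert x (E - X - {y}) \<in> dual E \<B> \<longleftrightarrow> insert y (X - {x}) \<in> \<B>" if "x \<in> X" "y \<in> E - X" for x y
  proof -
    have "E - insert x (E - X - {y}) = insert y (X - {x})" using that assms by auto
    moreover have "insert x (E - X - {y}) \<subseteq> E" using that assms by auto
    ultimately show ?thesis using in_dual_iff[OF assms(1)] by metis
  qed
  then show ?thesis using assms(2) by (auto simp: bad_cols_def bad_rows_def)
qed

text \<open>The basis entries fill the rectangle of good rows and good columns. If X - x + y0 and X
  - x0 + y are bases, exchanging \<open>y0\<close> out of the first admits only \<open>y\<close> or
  \<open>x\<close>; the latter would give the non-basis \<open>X\<close>, so the result is X - x +
  y.\<close>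

lemma nonbasis_neighbour:
  assumes M: "matroid E \<B>" and X: "X \<notin> \<B>" and xy: "x \<in> X" "y \<in> E - X"
  shows "insert y (X - {x}) \<notin> \<B> \<longleftrightarrow> x \<in> bad_rows E \<B> X \<or> y \<in> bad_cols E \<B> X"
proof
  assume nb: "insert y (X - {x}) \<notin> \<B>"
  show "x \<in> bad_rows E \<B> X \<or> y \<in> bad_cols E \<B> X"
  proof (rule ccontr)
    assume "\<not> ?thesis"
    then have "\<exists>y0\<in>E - X. insert y0 (X - {x}) \<in> \<B>" "\<exists>x0\<in>X. insert y (X - {x0}) \<in> \<B>"
      using xy by (simp_all add: bad_rows_def bad_cols_def)
    then obtain x0 y0 where *: "y0 \<in> E - X" "insert y0 (X - {x}) \<in> \<B>"
      "x0 \<in> X" "insert y (X - {x0}) \<in> \<B>"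
      by blast
    have "x0 \<noteq> x" "y0 \<noteq> y" using * nb by auto
    then have "y0 \<in> insert y0 (X - {x}) - insert y (X - {x0})" using * by auto
    then obtain b where b: "b \<in> insert y (X - {x0}) - insert y0 (X - {x})"
      "insert b (insert y0 (X - {x}) - {y0}) \<in> \<B>"
      using matroid_exchange[OF M *(2,4)] by blast
    have "insert y0 (X - {x}) - {y0} = X - {x}" using *(1) by auto
    moreover have "b = y \<or> b = x" using b(1) by auto
    moreover have "insert x (X - {x}) = X" using xy by auto
    ultimately show False using b(2) nb X by (elim disjE) simp_all
  qed
qed (use xy in \<open>auto simp: bad_rows_def bad_cols_def\<close>)

lemma nonbasis_neighbours_eq:
  assumes "matroid E \<B>" "matroid E \<B>'" "X \<notin> \<B>" "X \<notin> \<B>'"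
    and "bad_rows E \<B> X = bad_rows E \<B>' X" "bad_cols E \<B> X = bad_cols E \<B>' X"
    and "Y \<in> nbrs E X"
  shows "Y \<in> \<B> \<longleftrightarrow> Y \<in> \<B>'"
proof -
  obtain x y where xy: "x \<in> X" "y \<in> E - X" "Y = insert y (X - {x})"
    using assms(7) by (auto simp: nbrs_def)
  show ?thesis
    using nonbasis_neighbour[OF assms(1,3) xy(1,2)] nonbasis_neighbour[OF assms(2,4) xy(1,2)]
      assms(5,6) xy(3) by auto
qed

text \<open>The basis neighbour shows that X - x is independent of size r - 1. Its closure contains
  x, since \<open>X\<close> is not a basis, and every bad column.\<close>

lemma many_bad_cols_in_big_hyp:
  assumes M: "matroid E \<B>" and B: "\<B> \<subseteq> ksets E r" and X: "X \<in> ksets E r" "X \<notin> \<B>"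
    and t: "t \<le> card (bad_cols E \<B> X)"
    and xy: "x \<in> X" "y \<in> E - X" "insert y (X - {x}) \<in> \<B>"
  obtains H where "H \<in> big_hyps E \<B> r t" "X \<subseteq> H"
proof -
  have finE: "finite E" using matroid_finite[OF M] .
  have fX: "finite X" "card X = r" "X \<subseteq> E" using X finE finite_subset by (auto simp: ksets_def)
  have nonind: "\<not> indep \<B> Y" if Y: "card Y = r" "Y \<notin> \<B>" for Y
  proof
    assume "indep \<B> Y"
    moreover have "card (insert y (X - {x})) = r" using xy(3) B by (auto simp: ksets_def)
    ultimately show False using full_indep_basis[OF M _ _ xy(3)] Y by auto
  qed
  define I where "I = X - {x}"
  have I: "indep \<B> I" "Suc (card I) = r"
    using xy fX card_Suc_Diff1[of X x] by (auto simp: indep_def I_def)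
  have sub: "X \<union> bad_cols E \<B> X \<subseteq> mspan E \<B> I"
  proof
    fix z assume z: "z \<in> X \<union> bad_cols E \<B> X"
    show "z \<in> mspan E \<B> I"
    proof (cases "z \<in> I")
      case True
      then show ?thesis using fX by (auto simp: mspan_def I_def)
    next
      case False
      have "insert z I \<notin> \<B>"
      proof (cases "z = x")
        case True
        then show ?thesis using X(2) xy(1) by (simp add: I_def insert_absorb)
      next
        case False
        then have "z \<in> bad_cols E \<B> X" using z \<open>z \<notin> I\<close> by (auto simp: I_def)
        then show ?thesis using xy(1) by (auto simp: bad_cols_def I_def)
      qed
      moreover have "card (insert z I) = r" using False I fX by (simp add: I_def)
      moreover have "z \<in> E" using z fX by (auto simp: bad_cols_def)
      ultimately show ?thesis using nonind by (auto simp: mspan_def)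
    qed
  qed
  have "card (X \<union> bad_cols E \<B> X) = r + card (bad_cols E \<B> X)"
    using fX finE by (subst card_Un_disjoint) (auto simp: bad_cols_def)
  moreover have "card (X \<union> bad_cols E \<B> X) \<le> card (mspan E \<B> I)"
    using sub finite_subset[OF mspan_subset finE] by (intro card_mono)
  ultimately have "mspan E \<B> I \<in> big_hyps E \<B> r t" using I t by (auto simp: big_hyps_def)
  then show thesis using that sub by blast
qed

text \<open>The $r$-sets not already known to be dependent when $\mathcal H$ and $\mathcal H'$ are the large
  hyperplanes of the matroid and of its dual; the latter encode the small circuits.\<close>

definition undecided :: "'a set \<Rightarrow> nat \<Rightarrow> 'a set set \<Rightarrow> 'a set set \<Rightarrow> 'a set set" where
  "undecided E r \<H> \<H>' = {X \<in> ksets E r. \<not> (\<exists>H\<in>\<H>. X \<subseteq> H) \<and> \<not> (\<exists>H\<in>\<H>'. E - X \<subseteq> H)}"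

lemma basis_undecided:
  assumes M: "matroid E \<B>" and B: "\<B> \<subseteq> ksets E r"
  shows "\<B> \<subseteq> undecided E r (big_hyps E \<B> r t) (big_hyps E (dual E \<B>) (card E - r) t)"
proof
  fix X assume X: "X \<in> \<B>"
  have finE: "finite E" using matroid_finite[OF M] .
  have Xk: "X \<in> ksets E r" "X \<subseteq> E" "card X = r" using X B by (auto simp: ksets_def)
  have d: "E - X \<in> dual E \<B>" using X by (auto simp: dual_def)
  have c: "card (E - X) = card E - r" using Xk finE finite_subset[of X E] by (simp add: card_Diff_subset)
  show "X \<in> undecided E r (big_hyps E \<B> r t) (big_hyps E (dual E \<B>) (card E - r) t)"
    using subset_big_hyp_nonbasis[OF M _ _ Xk(3)] X
      subset_big_hyp_nonbasis[OF matroid_dual[OF M] _ _ c] d Xk(1)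
    by (auto simp: undecided_def)
qed

text \<open>The pattern $(X, E - X)$ stands for rank at most $r - 2$, where all neighbours of $X$ are
  dependent.\<close>

definition bad_patterns :: "'a set \<Rightarrow> nat \<Rightarrow> 'a set \<Rightarrow> ('a set \<times> 'a set) set" where
  "bad_patterns E t X = insert (X, E - X) ({R. R \<subseteq> E \<and> card R < t} \<times> {D. D \<subseteq> E \<and> card D < t})"

text \<open>If some neighbour is a basis, \<open>t\<close> bad columns would put \<open>X\<close>
  below a listed hyperplane, and \<open>t\<close> bad rows would do the same for
  \<open>E - X\<close> in the dual. If none is, every row and every column is bad, which is the
  extra pattern.\<close>

lemma undecided_bad_patterns:
  assumes M: "matroid E \<B>" and B: "\<B> \<subseteq> ksets E r" and r: "1 \<le> r" "r < card E"
    and X: "X \<in> undecided E r (big_hyps E \<B> r t) (big_hyps E (dual E \<B>) (card E - r) t)" "X \<notin> \<B>"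
  shows "(bad_rows E \<B> X, bad_cols E \<B> X) \<in> bad_patterns E t X"
proof (cases "\<exists>x\<in>X. \<exists>y\<in>E - X. insert y (X - {x}) \<in> \<B>")
  case True
  then obtain x y where xy: "x \<in> X" "y \<in> E - X" "insert y (X - {x}) \<in> \<B>" by blast
  have finE: "finite E" using matroid_finite[OF M] .
  have BP: "\<B> \<subseteq> Pow E" using B by (auto simp: ksets_def)
  have Xk: "X \<in> ksets E r" "X \<subseteq> E" using X(1) by (auto simp: undecided_def ksets_def)
  have "card (bad_cols E \<B> X) < t"
    using many_bad_cols_in_big_hyp[OF M B Xk(1) X(2) _ xy, of t] X(1)
    by (metis (no_types, lifting) mem_Collect_eq not_le undecided_def)
  moreover have "card (bad_rows E \<B> X) < t"
  proof (rule ccontr)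
    assume "\<not> ?thesis"
    then have t: "t \<le> card (bad_cols E (dual E \<B>) (E - X))" using bad_cols_dual[OF BP Xk(2)] by simp
    have "E - X \<in> ksets E (card E - r)"
      using Xk finE finite_subset[of X E] by (auto simp: ksets_def card_Diff_subset)
    moreover have "E - X \<notin> dual E \<B>" using in_dual_iff[OF BP, of "E - X"] X(2) Xk(2) by (simp add: double_diff)
    moreover have "insert x (E - X - {y}) \<in> dual E \<B>"
    proof -
      have "insert x (E - X - {y}) = E - insert y (X - {x})" using xy Xk(2) by auto
      then show ?thesis using xy(3) by (auto simp: dual_def)
    qed
    moreover have "x \<in> E - (E - X)" using xy Xk(2) by auto
    ultimately obtain H where "H \<in> big_hyps E (dual E \<B>) (card E - r) t" "E - X \<subseteq> H"
      using many_bad_cols_in_big_hyp[OF matroid_dual[OF M] dual_ksets[OF finE B] _ _ t, of y x] xy(2) by metis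
    then show False using X(1) by (auto simp: undecided_def)
  qed
  moreover have "bad_rows E \<B> X \<subseteq> E" "bad_cols E \<B> X \<subseteq> E"
    using Xk(2) by (auto simp: bad_rows_def bad_cols_def)
  ultimately show ?thesis by (simp add: bad_patterns_def)
next
  case False
  have "card X = r" "X \<subseteq> E" "finite E"
    using X(1) matroid_finite[OF M] by (auto simp: undecided_def ksets_def)
  then have "X \<noteq> {}" "E - X \<noteq> {}" using r by auto
  then have "bad_rows E \<B> X = X" "bad_cols E \<B> X = E - X"
    using False by (auto simp: bad_rows_def bad_cols_def)
  then show ?thesis by (simp add: bad_patterns_def)
qed

text \<open>Needed at two levels: for sets of bad rows or columns, and with \<open>Pow E\<close> as
  ground set for short lists of hyperplanes.\<close>

lemma card_subsets_less:
  assumes finE: "finite E"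
  shows "card {R. R \<subseteq> E \<and> card R < t} \<le> (card E + 1) ^ t"
proof (induction t)
  case (Suc t)
  have "{R. R \<subseteq> E \<and> card R < Suc t} \<subseteq> {R. R \<subseteq> E \<and> card R < t} \<union> ksets E t"
    by (auto simp: ksets_def)
  then have "card {R. R \<subseteq> E \<and> card R < Suc t} \<le> card ({R. R \<subseteq> E \<and> card R < t} \<union> ksets E t)"
    using finE by (intro card_mono) auto
  also have "\<dots> \<le> card {R. R \<subseteq> E \<and> card R < t} + card (ksets E t)" by (rule card_Un_le)
  also have "card (ksets E t) \<le> card E ^ t"
    using card_ksets[OF finE, of t] binomial_fact_pow[of "card E" t]
    by (metis fact_ge_1 mult.right_neutral mult_le_mono2 order_trans)
  also have "card {R. R \<subseteq> E \<and> card R < t} + card E ^ t \<le> (card E + 1) ^ t + card E * (card E + 1) ^ t"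
  proof (cases "t = 0 \<or> card E = 0")
    case True
    then show ?thesis using Suc by (cases t) (auto simp: power_0_left)
  next
    case False
    have "1 * card E ^ t \<le> card E * (card E + 1) ^ t"
      using False by (intro mult_mono power_mono) auto
    then show ?thesis using Suc by simp
  qed
  finally show ?case by (simp add: algebra_simps)
qed simp

lemma card_bad_patterns:
  assumes finE: "finite E"
  shows "finite (bad_patterns E t X)" "card (bad_patterns E t X) \<le> (card E + 1) ^ (2 * t) + 1"
proof -
  let ?S = "{R. R \<subseteq> E \<and> card R < t}"
  have fin: "finite ?S" using finE by (auto intro: finite_subset[of _ "Pow E"])
  then show "finite (bad_patterns E t X)" by (simp add: bad_patterns_def)
  have "card (bad_patterns E t X) \<le> Suc (card (?S \<times> ?S))"
    unfolding bad_patterns_def by (rule card_insert_le_m1) auto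
  also have "card (?S \<times> ?S) \<le> (card E + 1) ^ t * (card E + 1) ^ t"
    unfolding card_cartesian_product by (intro mult_mono card_subsets_less finE) auto
  finally show "card (bad_patterns E t X) \<le> (card E + 1) ^ (2 * t) + 1"
    by (simp add: power_add[symmetric] mult_2)
qed

section \<open>Counting matroids of fixed rank\<close>

text \<open>\<open>container_count\<close> on the undecided sets, which include all bases, so the
  non-bases among them determine \<B>. The threshold 2K/r is where the main term of
  \<open>johnson_degree\<close> is twice the subtracted one; halving it leaves \<delta> =
  r^2/(2K).\<close>

lemma card_matroids_given_hyps:
  fixes E :: "'a set"
  assumes finE: "finite E" and r: "1 \<le> r" "r < card E"
  defines "K \<equiv> real (card E choose (r - 1))"
  assumes K: "(real r)\<^sup>2 \<le> 2 * K"
    and q: "real (card E choose r) * (1 - (real r)\<^sup>2 / (2 * K)) ^ q \<le> 2 * K / real r"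
  shows "real (card {\<B>. matroid E \<B> \<and> \<B> \<subseteq> ksets E r \<and> big_hyps E \<B> r t = \<H> \<and>
      big_hyps E (dual E \<B>) (card E - r) t = \<H>'})
    \<le> 2 powr (2 * K / real r) *
      (\<Sum>s\<le>q. real ((card E choose r) choose s) * real ((card E + 1) ^ (2 * t) + 1) ^ s)"
proof -
  define A where "A = undecided E r \<H> \<H>'"
  define \<K> where "\<K> = {\<B>. matroid E \<B> \<and> \<B> \<subseteq> ksets E r \<and> big_hyps E \<B> r t = \<H> \<and>
      big_hyps E (dual E \<B>) (card E - r) t = \<H>'}"
  have Kpos: "0 < K" using r by (simp add: K_def)
  have AE: "A \<subseteq> ksets E r" by (auto simp: A_def undecided_def)
  have finA: "finite A" using AE finite_ksets[OF finE] finite_subset by metis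
  have cA: "card A \<le> card E choose r"
    using card_mono[OF finite_ksets[OF finE] AE] card_ksets[OF finE] by simp
  have finK: "finite \<K>"
    by (rule finite_subset[of _ "Pow (ksets E r)"]) (auto simp: \<K>_def finE)
  have BA: "\<B> \<subseteq> A" if "\<B> \<in> \<K>" for \<B>
    using basis_undecided[of E \<B> r t] that by (auto simp: \<K>_def A_def)
  have "real (card \<K>) \<le> 2 powr (2 * K / real r) *
      (\<Sum>s\<le>q. real (card A choose s) * real ((card E + 1) ^ (2 * t) + 1) ^ s)"
  proof (rule container_count[where nb="\<lambda>\<B>. - \<B>" and adj="nbrs E" and G="bad_patterns E t"
        and info="\<lambda>\<B> X. (bad_rows E \<B> X, bad_cols E \<B> X)" and \<delta>="(real r)\<^sup>2 / (2 * K)"])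
    show "M = M'" if "M \<in> \<K>" "M' \<in> \<K>" "- M \<inter> A = - M' \<inter> A" for M M'
      using that BA[of M] BA[of M'] by blast
    show "finite (bad_patterns E t v) \<and> card (bad_patterns E t v) \<le> (card E + 1) ^ (2 * t) + 1" for v
      using card_bad_patterns[OF finE] by blast
    show "(bad_rows E M v, bad_cols E M v) \<in> bad_patterns E t v"
      if "M \<in> \<K>" "v \<in> A" "v \<in> - M" for M v
      using that undecided_bad_patterns[of E M r v t] r by (auto simp: \<K>_def A_def)
    show "nbrs E v \<inter> A \<inter> - M = nbrs E v \<inter> A \<inter> - M'"
      if "M \<in> \<K>" "M' \<in> \<K>" "v \<in> - M" "v \<in> - M'"
        "(bad_rows E M v, bad_cols E M v) = (bad_rows E M' v, bad_cols E M' v)" for M M' v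
      using that nonbasis_neighbours_eq[of E M M' v] by (auto simp: \<K>_def)
    show "\<exists>v\<in>A'. (real r)\<^sup>2 / (2 * K) * real (card A') \<le> real (card (nbrs E v \<inter> A'))"
      if A': "A' \<subseteq> A" "2 * K / real r < real (card A')" for A'
    proof -
      have "A' \<noteq> {}" using A'(2) Kpos r by (auto simp: field_simps)
      then obtain v where v: "v \<in> A'"
        "real r * (real r * real (card A') / K - 1) \<le> real (card (nbrs E v \<inter> A'))"
        using johnson_degree[OF finE r(1), of A'] A'(1) AE K_def by blast
      have half: "z / 2 \<le> z - 1" if "2 \<le> z" for z :: real using that by simp
      have "2 \<le> real r * real (card A') / K" using A'(2) Kpos r by (simp add: field_simps)
      then have "real r * (real r * real (card A') / K / 2) \<le> real r * (real r * real (card A') / K - 1)"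
        by (intro mult_left_mono half) auto
      moreover have "(real r)\<^sup>2 / (2 * K) * real (card A') = real r * (real r * real (card A') / K / 2)"
        by (simp add: power2_eq_square)
      ultimately show ?thesis using v by force
    qed
    have "real (card A) * (1 - (real r)\<^sup>2 / (2 * K)) ^ q
        \<le> real (card E choose r) * (1 - (real r)\<^sup>2 / (2 * K)) ^ q"
      using cA K Kpos by (intro mult_right_mono zero_le_power) (auto simp: field_simps)
    then show "real (card A) * (1 - (real r)\<^sup>2 / (2 * K)) ^ q \<le> 2 * K / real r" using q by simp
  qed (use Kpos K finA finK r in \<open>auto simp: field_simps\<close>)
  also have "\<dots> \<le> 2 powr (2 * K / real r) *
      (\<Sum>s\<le>q. real ((card E choose r) choose s) * real ((card E + 1) ^ (2 * t) + 1) ^ s)"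
    using cA by (intro mult_left_mono sum_mono mult_right_mono) (auto simp: binomial_right_mono)
  finally show ?thesis by (simp add: \<K>_def)
qed

lemma card_not_thin_dual:
  assumes finE: "finite E"
  shows "card {\<B>. matroid E \<B> \<and> \<B> \<subseteq> ksets E r \<and> \<not> thin E (dual E \<B>) k e}
    \<le> 2 ^ card E * 2 ^ (\<Sum>i<k. (e choose i) * ((card E - e) choose (card E - r - i)))"
proof -
  have "card {\<B>. matroid E \<B> \<and> \<B> \<subseteq> ksets E r \<and> \<not> thin E (dual E \<B>) k e}
      \<le> card {\<B>. matroid E \<B> \<and> \<B> \<subseteq> ksets E (card E - r) \<and> \<not> thin E \<B> k e}"
  proof (rule card_inj_on_le[where f="dual E"])
    show "inj_on (dual E) {\<B>. matroid E \<B> \<and> \<B> \<subseteq> ksets E r \<and> \<not> thin E (dual E \<B>) k e}"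
      by (rule inj_on_inverseI[where g="dual E"]) (auto intro!: dual_dual simp: ksets_def)
    show "dual E ` {\<B>. matroid E \<B> \<and> \<B> \<subseteq> ksets E r \<and> \<not> thin E (dual E \<B>) k e}
        \<subseteq> {\<B>. matroid E \<B> \<and> \<B> \<subseteq> ksets E (card E - r) \<and> \<not> thin E \<B> k e}"
      using matroid_dual dual_ksets[OF finE] by blast
    show "finite {\<B>. matroid E \<B> \<and> \<B> \<subseteq> ksets E (card E - r) \<and> \<not> thin E \<B> k e}"
      by (rule finite_subset[of _ "Pow (ksets E (card E - r))"]) (auto simp: finE)
  qed
  then show ?thesis using card_not_thin[OF finE, of "card E - r" k e] by simp
qed

text \<open>The first two terms count matroids that are not thin or whose dual is not. For all
  others the hypotheses \<open>h\<close> leave at most h large hyperplanes on either side; both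
  lists are guessed before the containers are applied.\<close>

lemma card_matroids_rank_le:
  fixes E :: "'a set"
  assumes finE: "finite E" and r: "1 \<le> r" "r < card E" and k: "k < r" "k < card E - r"
    and h: "r ^ k * (card E choose (r - 1)) \<le> h * (r + e) ^ k"
      "(card E - r) ^ k * (card E choose (card E - r - 1)) \<le> h * (card E - r + e) ^ k"
  defines "K \<equiv> real (card E choose (r - 1))"
  assumes K: "(real r)\<^sup>2 \<le> 2 * K"
    and q: "real (card E choose r) * (1 - (real r)\<^sup>2 / (2 * K)) ^ q \<le> 2 * K / real r"
  shows "real (card {\<B>. matroid E \<B> \<and> \<B> \<subseteq> ksets E r})
    \<le> 2 ^ (card E + (\<Sum>i<k. (e choose i) * ((card E - e) choose (r - i))))
      + 2 ^ (card E + (\<Sum>i<k. (e choose i) * ((card E - e) choose (card E - r - i))))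
      + (2 ^ card E + 1) ^ (2 * h + 2) * (2 powr (2 * K / real r) *
      (\<Sum>s\<le>q. real ((card E choose r) choose s) * real ((card E + 1) ^ (4 * e) + 1) ^ s))"
proof -
  define M where "M = {\<B>. matroid E \<B> \<and> \<B> \<subseteq> ksets E r}"
  define N1 where "N1 = {\<B>. matroid E \<B> \<and> \<B> \<subseteq> ksets E r \<and> \<not> thin E \<B> k e}"
  define N2 where "N2 = {\<B>. matroid E \<B> \<and> \<B> \<subseteq> ksets E r \<and> \<not> thin E (dual E \<B>) k e}"
  define P where "P = (\<lambda>(\<H>, \<H>'). {\<B>. matroid E \<B> \<and> \<B> \<subseteq> ksets E r \<and> big_hyps E \<B> r (2 * e) = \<H> \<and>
      big_hyps E (dual E \<B>) (card E - r) (2 * e) = \<H>'})"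
  define F where "F = {\<H>. \<H> \<subseteq> Pow E \<and> card \<H> < h + 1}"
  define b where "b = 2 powr (2 * K / real r) *
      (\<Sum>s\<le>q. real ((card E choose r) choose s) * real ((card E + 1) ^ (4 * e) + 1) ^ s)"
  have finM: "finite M"
    by (rule finite_subset[of _ "Pow (ksets E r)"]) (auto simp: M_def finE)
  have finF: "finite F" using finE by (auto simp: F_def intro: finite_subset[of _ "Pow (Pow E)"])
  have cF: "card F \<le> (2 ^ card E + 1) ^ (h + 1)"
    using card_subsets_less[of "Pow E" "h + 1"] finE by (simp add: F_def card_Pow)
  have small: "card (big_hyps E \<B> s (2 * e)) < h + 1"
    if "matroid E \<B>" "thin E \<B> k e" "k < s" "s ^ k * (card E choose (s - 1)) \<le> h * (s + e) ^ k" for \<B> s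
  proof -
    have "card (big_hyps E \<B> s (2 * e)) * (s + 2 * e - e) ^ k \<le> h * (s + e) ^ k"
      using card_big_hyps[OF that(1-3), of "2 * e"] that(4) by simp
    \<comment> \<open>The threshold t = 2e leaves a surplus of e over the flats of size at most e
      that are discarded, hence the ratio (s + e)/s. It also explains the exponent 4e in the number
      of patterns.\<close>
    moreover have "s + 2 * e - e = s + e" by simp
    ultimately show ?thesis using that(3) by (simp del: power_add)
  qed
  have "M \<subseteq> N1 \<union> N2 \<union> (\<Union>p\<in>F \<times> F. P p)"
  proof
    fix \<B> assume B: "\<B> \<in> M"
    show "\<B> \<in> N1 \<union> N2 \<union> (\<Union>p\<in>F \<times> F. P p)"
    proof (cases "\<B> \<in> N1 \<union> N2")
      case False
      then have t: "thin E \<B> k e" "thin E (dual E \<B>) k e" and m: "matroid E \<B>" "\<B> \<subseteq> ksets E r"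
        using B by (auto simp: M_def N1_def N2_def)
      have "big_hyps E \<B> r (2 * e) \<in> F" "big_hyps E (dual E \<B>) (card E - r) (2 * e) \<in> F"
        using small[OF m(1) t(1) k(1) h(1)] small[OF matroid_dual[OF m(1)] t(2) k(2) h(2)]
          big_hyps_subset[of E] by (simp_all add: F_def)
      moreover have "\<B> \<in> P (big_hyps E \<B> r (2 * e), big_hyps E (dual E \<B>) (card E - r) (2 * e))"
        using m by (simp add: P_def)
      ultimately show ?thesis by blast
    qed simp
  qed
  moreover have "N1 \<union> N2 \<union> (\<Union>p\<in>F \<times> F. P p) \<subseteq> M" by (auto simp: M_def N1_def N2_def P_def)
  ultimately have "M = N1 \<union> N2 \<union> (\<Union>p\<in>F \<times> F. P p)" by blast
  then have "card M \<le> card (N1 \<union> N2) + card (\<Union>p\<in>F \<times> F. P p)"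
    using card_Un_le by simp
  also have "\<dots> \<le> card N1 + card N2 + (\<Sum>p\<in>F \<times> F. card (P p))"
    using finF by (intro add_mono card_Un_le card_UN_le) auto
  finally have "real (card M) \<le> real (card N1) + real (card N2) + (\<Sum>p\<in>F \<times> F. real (card (P p)))"
    by (simp only: of_nat_add[symmetric] of_nat_sum[symmetric] of_nat_le_iff)
  also have "(\<Sum>p\<in>F \<times> F. real (card (P p))) \<le> real (card (F \<times> F)) * b"
  proof (rule sum_bounded_above)
    fix p assume "p \<in> F \<times> F"
    obtain \<H> \<H>' where "p = (\<H>, \<H>')" by fastforce
    then show "real (card (P p)) \<le> b"
      using card_matroids_given_hyps[OF finE r K[unfolded K_def] q[unfolded K_def], of "2 * e" \<H> \<H>']
      by (simp add: P_def b_def K_def)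
  qed
  finally have main: "real (card M) \<le> real (card N1) + real (card N2) + real (card (F \<times> F)) * b"
    by simp
  have pow_real: "real m \<le> 2 ^ a" if "m \<le> 2 ^ a" for m a :: nat
    using that of_nat_le_iff[of m "2 ^ a", where 'a=real] by simp
  have n1: "real (card N1) \<le> 2 ^ (card E + (\<Sum>i<k. (e choose i) * ((card E - e) choose (r - i))))"
    using card_not_thin[OF finE, of r k e] unfolding N1_def power_add[symmetric] by (rule pow_real)
  have n2: "real (card N2) \<le> 2 ^ (card E + (\<Sum>i<k. (e choose i) * ((card E - e) choose (card E - r - i))))"
    using card_not_thin_dual[OF finE, of r k e] unfolding N2_def power_add[symmetric] by (rule pow_real)
  have "real (card (F \<times> F)) \<le> (2 ^ card E + 1) ^ (2 * h + 2)"
  proof -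
    have "card (F \<times> F) \<le> (2 ^ card E + 1) ^ (h + 1) * (2 ^ card E + 1) ^ (h + 1)"
      unfolding card_cartesian_product using cF by (intro mult_mono) auto
    also have "\<dots> = (2 ^ card E + 1) ^ (h + 1 + (h + 1))" by (rule power_add[symmetric])
    also have "h + 1 + (h + 1) = 2 * h + 2" by simp
    finally have "real (card (F \<times> F)) \<le> real ((2 ^ card E + 1) ^ (2 * h + 2))"
      by (simp only: of_nat_le_iff)
    then show ?thesis by (simp only: of_nat_power of_nat_add of_nat_numeral of_nat_1)
  qed
  then have "real (card (F \<times> F)) * b \<le> (2 ^ card E + 1) ^ (2 * h + 2) * b"
    by (rule mult_right_mono) (simp add: b_def sum_nonneg)
  then show ?thesis using main n1 n2 unfolding M_def b_def by linarith
qed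

text \<open>For s \<le> q the weight g^s is at most (g/x)^q x^s, and the full binomial sum is (1 +
  x)^m \<le> exp (x m). A free choice of \<open>x\<close> replaces estimates for binomial
  coefficients.\<close>

lemma binomial_weight_le:
  fixes g x :: real
  assumes g: "1 \<le> g" and x: "0 < x" "x \<le> 1"
  shows "(\<Sum>s\<le>q. real (m choose s) * g ^ s) \<le> (g / x) ^ q * exp (x * real m)"
proof -
  have "real (m choose s) * g ^ s \<le> (g / x) ^ q * (real (m choose s) * x ^ s)" if "s \<le> q" for s
  proof -
    have "g ^ s = (g / x) ^ s * x ^ s" using x by (simp add: power_divide)
    also have "\<dots> \<le> (g / x) ^ q * x ^ s"
      using that g x by (intro mult_right_mono power_increasing) (auto simp: field_simps)
    finally have "real (m choose s) * g ^ s \<le> real (m choose s) * ((g / x) ^ q * x ^ s)"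
      by (intro mult_left_mono) auto
    then show ?thesis by (simp add: mult_ac)
  qed
  then have "(\<Sum>s\<le>q. real (m choose s) * g ^ s) \<le> (\<Sum>s\<le>q. (g / x) ^ q * (real (m choose s) * x ^ s))"
    by (intro sum_mono) auto
  also have "\<dots> = (g / x) ^ q * (\<Sum>s\<le>q. real (m choose s) * x ^ s)"
    by (simp add: sum_distrib_left)
  also have "(\<Sum>s\<le>q. real (m choose s) * x ^ s) \<le> (\<Sum>s\<le>max q m. real (m choose s) * x ^ s)"
    using x by (intro sum_mono2) auto
  also have "\<dots> = (\<Sum>s\<le>m. real (m choose s) * x ^ s)"
    by (rule sum.mono_neutral_right) (auto simp: binomial_eq_0)
  also have "\<dots> = (x + 1) ^ m" by (simp add: binomial_ring)
  also have "\<dots> \<le> exp x ^ m" using x exp_ge_add_one_self[of x] by (intro power_mono) (auto simp: add.commute)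
  also have "\<dots> = exp (x * real m)" by (simp add: exp_of_nat_mult[symmetric] mult.commute)
  finally show ?thesis using g x by (simp add: mult_left_mono)
qed

section \<open>Asymptotics for middle ranks\<close>

lemma binomial_step: "(n - k) * (n choose k) = Suc k * (n choose Suc k)"
  using binomial_absorb_comp[of n k] binomial_absorption[of k n] by simp

text \<open>Deleting one element from a ground set of size n' \<le> n multiplies the number of
  m-subsets by (n' - m)/n' \<le> 7/8.\<close>

lemma binomial_ground_diff:
  assumes m: "n \<le> 8 * m" and e: "e \<le> n"
  shows "real ((n - e) choose m) \<le> (7/8) ^ e * real (n choose m)"
  using e
proof (induction e)
  case (Suc e)
  let ?n = "n - e"
  have n: "0 < ?n" "n - Suc e = ?n - 1" using Suc.prems by auto
  have "real (?n - m) * real (?n choose m) = real ?n * real ((?n - 1) choose m)"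
    using binomial_absorb_comp[of ?n m] by (simp only: of_nat_mult[symmetric])
  moreover have "real (?n - m) \<le> 7/8 * real ?n" using m by linarith
  then have "real (?n - m) * real (?n choose m) \<le> 7/8 * real ?n * real (?n choose m)"
    by (rule mult_right_mono) simp
  ultimately have "real ?n * real ((?n - 1) choose m) \<le> real ?n * (7/8 * real (?n choose m))"
    by (simp add: mult_ac)
  then have "real ((?n - 1) choose m) \<le> 7/8 * real (?n choose m)" using n(1) by simp
  also have "\<dots> \<le> 7/8 * ((7/8) ^ e * real (n choose m))" using Suc by simp
  finally show ?case unfolding n(2) by (simp only: power_Suc mult.assoc)
qed simp

lemma binomial_lower_le:
  assumes r: "4 * r \<le> 3 * n" and i: "i \<le> r"
  shows "n choose (r - i) \<le> 3 ^ i * (n choose r)"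
  using i
proof (induction i)
  case (Suc i)
  let ?k = "r - Suc i"
  have k: "Suc ?k = r - i" using Suc.prems by simp
  have "Suc ?k \<le> 3 * (n - ?k)" using r Suc.prems by linarith
  then have "(n - ?k) * (n choose ?k) \<le> (n - ?k) * (3 * (n choose Suc ?k))"
    unfolding binomial_step using mult_le_mono1 by (metis mult.assoc mult.commute)
  moreover have "0 < n - ?k" using r Suc.prems by linarith
  ultimately have "n choose ?k \<le> 3 * (n choose (r - i))" using k by simp
  then show ?case using Suc by simp
qed simp

text \<open>Choosing the small intersection costs only (3n)^k, whereas avoiding the rest of an e-set
  gains (7/8)^e.\<close>

lemma few_meeting_sets:
  assumes r: "n \<le> 4 * r" "4 * r \<le> 3 * n" and k: "8 * k \<le> n" and e: "e \<le> n"
  shows "real (\<Sum>i<k. (e choose i) * ((n - e) choose (r - i)))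
    \<le> real k * (3 * real n) ^ k * (7/8) ^ e * real (n choose r)"
proof -
  have "real ((e choose i) * ((n - e) choose (r - i))) \<le> (3 * real n) ^ k * (7/8) ^ e * real (n choose r)"
    if i: "i < k" for i
  proof -
    have n1: "1 \<le> real n" using i k by simp
    have "e choose i \<le> e ^ i" using binomial_fact_pow[of e i]
      by (metis fact_ge_1 mult.right_neutral mult_le_mono2 order_trans)
    then have "real (e choose i) \<le> real e ^ i" by (metis of_nat_le_iff of_nat_power)
    also have "\<dots> \<le> real n ^ i" using e by (intro power_mono) auto
    also have "\<dots> \<le> real n ^ k" using i n1 by (intro power_increasing) auto
    finally have a: "real (e choose i) \<le> real n ^ k" .
    \<comment> \<open>The remaining size is at least n/4 - n/8; this is where the base 7/8 comes
      from.\<close>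
    have "n \<le> 8 * (r - i)" using r k i by linarith
    then have "real ((n - e) choose (r - i)) \<le> (7/8) ^ e * real (n choose (r - i))"
      using binomial_ground_diff e by blast
    also have "real (n choose (r - i)) \<le> 3 ^ k * real (n choose r)"
    proof -
      have "n choose (r - i) \<le> 3 ^ i * (n choose r)" using binomial_lower_le r k i by simp
      also have "\<dots> \<le> 3 ^ k * (n choose r)" using i by (intro mult_right_mono power_increasing) auto
      finally have "real (n choose (r - i)) \<le> real (3 ^ k * (n choose r))" by (simp only: of_nat_le_iff)
      then show ?thesis by simp
    qed
    finally have b: "real ((n - e) choose (r - i)) \<le> (7/8) ^ e * (3 ^ k * real (n choose r))" by simp
    have "real (e choose i) * real ((n - e) choose (r - i)) \<le> real n ^ k * ((7/8) ^ e * (3 ^ k * real (n choose r)))"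
      by (rule mult_mono[OF a b]) auto
    then show ?thesis by (simp add: power_mult_distrib mult_ac)
  qed
  then have "(\<Sum>i<k. real ((e choose i) * ((n - e) choose (r - i))))
      \<le> real (card {..<k}) * ((3 * real n) ^ k * (7/8) ^ e * real (n choose r))"
    by (intro sum_bounded_above) auto
  then show ?thesis by (simp add: mult_ac)
qed

text \<open>The bound (n/r)^r with n/r \<ge> 4/3 and r \<ge> n/4. It ensures that additive terms
  polynomial in n are negligible against N/n.\<close>

lemma binomial_middle_ge:
  assumes r: "n \<le> 4 * r" "4 * r \<le> 3 * n" "0 < n"
  shows "(4/3) powr (real n / 4) \<le> real (n choose r)"
proof -
  have "(4/3 :: real) powr (real n / 4) \<le> (4/3) powr real r" using r by (intro powr_mono) auto
  also have "\<dots> = (4/3) ^ r" by (simp add: powr_realpow)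
  also have "\<dots> \<le> (real n / real r) ^ r" using r by (intro power_mono) (auto simp: field_simps)
  also have "\<dots> \<le> real (n choose r)" using r by (intro binomial_ge_n_over_k_pow_k) auto
  finally show ?thesis .
qed

text \<open>The choice $k \approx n^{2/5}$, $e \approx n^{4/5}$ makes $ke/n$ a positive power of $n$, so that large
  hyperplanes have exponentially many bases, while $k \log n = o(e)$ makes matroids that are not thin
  rare and $e \log^3 n = o(n)$ keeps the container encoding short.\<close>

lemma card_matroids_middle_rank:
  "\<forall>\<^sub>F n in sequentially. \<forall>r. n \<le> 4 * r \<and> 4 * r \<le> 3 * n \<longrightarrow>
    real (card {\<B>. matroid {1..n} \<B> \<and> \<B> \<subseteq> ksets {1..n} r}) \<le> 2 powr (10 * real (n choose r) / real n)"
proof -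
  \<comment> \<open>The comparisons of growth, with k \<le> 2 n^(2/5) and e \<le> 2 n^(4/5)
    substituted. The three long ones serve the matroids that are not thin, the lists of large
    hyperplanes, and the container encoding, in this order.\<close>
  have ev: "\<forall>\<^sub>F n in sequentially. 100 \<le> n \<and>
      8 * (2 * real n powr (2/5)) + 8 \<le> real n \<and> 2 * real n powr (4/5) \<le> real n \<and>
      (2 * real n powr (2/5)) * (3 * real n) powr (2 * real n powr (2/5)) * (7/8) powr (real n powr (4/5)) \<le> 1 / real n \<and>
      48 * real n * (real n + 1) * (real n / (real n + real n powr (4/5))) powr (real n powr (2/5)) \<le> 1 \<and>
      (11 * ln (real n) / (real n)\<^sup>2 + 1 / real n ^ 4) * ((8 * real n powr (4/5) + 3) * log 2 (real n + 1)) \<le> 1 / (2 * real n) \<and>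
      real n ^ 4 \<le> (4/3) powr (real n / 4) \<and> 1 \<le> real n powr (2/5)"
    by (intro eventually_conj eventually_ge_at_top; real_asymp)
  show ?thesis
    using ev
  proof eventually_elim
    case (elim n)
    define k where "k = nat \<lceil>real n powr (2/5)\<rceil>"
    define e where "e = nat \<lceil>real n powr (4/5)\<rceil>"
    have n100: "100 \<le> n" "100 \<le> real n" using elim by auto
    have n4: "real n * real n \<le> real n ^ 4" "2 * real n \<le> real n ^ 4"
      "32 * real n * (real n + 1) \<le> real n ^ 4"
    proof -
      have "100 * real n \<le> real n * real n" using n100 by (intro mult_right_mono) auto
      moreover have "100 * (real n * real n) \<le> real n * (real n * real n)"
        using n100 by (intro mult_right_mono) auto
      moreover have "100 * (real n * (real n * real n)) \<le> real n * (real n * (real n * real n))"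
        using n100 by (intro mult_right_mono) auto
      moreover have "real n ^ 4 = real n * (real n * (real n * real n))" by (simp add: power4_eq_xxxx)
      moreover have "32 * real n * (real n + 1) = 32 * (real n * real n) + 32 * real n"
        by (simp add: algebra_simps)
      ultimately show "real n * real n \<le> real n ^ 4" "2 * real n \<le> real n ^ 4"
        "32 * real n * (real n + 1) \<le> real n ^ 4" using n100 by linarith+
    qed
    have n45: "1 \<le> real n powr (4/5)" using n100 by (intro ge_one_powr_ge_zero) auto
    have k: "real n powr (2/5) \<le> real k" "real k \<le> 2 * real n powr (2/5)"
      unfolding k_def using elim by linarith+
    have e: "real n powr (4/5) \<le> real e" "real e \<le> 2 * real n powr (4/5)"
      unfolding e_def using n45 by linarith+
    have k8: "8 * k \<le> n" using k(2) elim by linarith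
    have en: "e \<le> n" using e(2) elim by linarith
    show ?case
    proof (intro allI impI)
      fix r assume r: "n \<le> 4 * r \<and> 4 * r \<le> 3 * n"
      define N where "N = real (n choose r)"
      define K where "K = real (n choose (r - 1))"
      \<comment> \<open>As s/(s + e) increases with s, \<rho> bounds (s/(s + e))^k for s = r and s =
        n - r at once. The 3 in \<open>h\<close> bounds the ratio of C(n, s-1) to C(n, s).\<close>
      define \<rho> where "\<rho> = (real n / (real n + real e)) ^ k"
      define h where "h = nat \<lceil>3 * N * \<rho>\<rceil>"
      \<comment> \<open>About (ln n)/\<delta> with \<delta> \<ge> n^2/(11 N): enough steps to shrink
        N vertices to N/n, which is below 2K/r.\<close>
      define q where "q = nat \<lceil>11 * N * ln (real n) / (real n)\<^sup>2\<rceil>"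
      define r' where "r' = n - r"
      have r': "n \<le> 4 * r'" "4 * r' \<le> 3 * n" using r unfolding r'_def by linarith+
      have r1: "1 \<le> r" "r < n" "1 \<le> r'" "r' < n" using r r' n100 by linarith+
      have N': "N = real (n choose r')" unfolding N_def r'_def using r1 binomial_symmetric[of r n] by simp
      have Nn4: "real n ^ 4 \<le> N"
        using binomial_middle_ge[of n r] r n100 elim unfolding N_def by linarith
      have Npos: "0 < N" using n4(2) Nn4 n100 by linarith
      have Nn: "1 / real n ^ 4 * N \<ge> 1" using Nn4 n100 by (simp add: field_simps)
      have \<rho>0: "0 \<le> \<rho>" by (simp add: \<rho>_def)
      have \<rho>: "48 * real n * (real n + 1) * \<rho> \<le> 1"
      proof -
        have "\<rho> \<le> (real n / (real n + real n powr (4/5))) ^ k"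
          unfolding \<rho>_def using e(1) n100 by (intro power_mono divide_left_mono mult_pos_pos add_pos_nonneg) auto
        also have "\<dots> = (real n / (real n + real n powr (4/5))) powr real k"
          using n100 by (simp add: powr_realpow add_pos_pos)
        also have "\<dots> \<le> (real n / (real n + real n powr (4/5))) powr (real n powr (2/5))"
          using k(1) n100 by (intro powr_mono') (auto simp: divide_le_eq_1 add_pos_nonneg)
        finally have "48 * real n * (real n + 1) * \<rho> \<le>
            48 * real n * (real n + 1) * (real n / (real n + real n powr (4/5))) powr (real n powr (2/5))"
          by (intro mult_left_mono) auto
        then show ?thesis using elim by linarith
      qed
      have K: "real r * N = (real n - real r + 1) * K"
      proof -
        have "(n - (r - 1)) * (n choose (r - 1)) = r * (n choose r)"
          using binomial_step[of n "r - 1"] r1 by simp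
        then have "real (n - (r - 1)) * K = real r * N"
          unfolding N_def K_def by (simp only: of_nat_mult[symmetric])
        moreover have "real (n - (r - 1)) = real n - real r + 1" using r1 by linarith
        ultimately show ?thesis by metis
      qed
      \<comment> \<open>The argument gives 2N/n; the weaker 9N/n is the exponent that the container
        term needs anyway.\<close>
      have small_T: "real (n + (\<Sum>i<k. (e choose i) * ((n - e) choose (s - i)))) \<le> 9 * N / real n"
        if s: "n \<le> 4 * s" "4 * s \<le> 3 * n" "N = real (n choose s)" for s
      proof -
        have "real (\<Sum>i<k. (e choose i) * ((n - e) choose (s - i)))
            \<le> real k * (3 * real n) ^ k * (7/8) ^ e * N"
          using few_meeting_sets[OF s(1,2) k8 en] s(3) by simp
        also have "real k * (3 * real n) ^ k * (7/8) ^ e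
            = real k * (3 * real n) powr real k * (7/8) powr real e"
          using n100 by (simp add: powr_realpow)
        also have "\<dots> \<le> (2 * real n powr (2/5)) * (3 * real n) powr (2 * real n powr (2/5))
            * (7/8) powr (real n powr (4/5))"
        proof (intro mult_mono)
          show "(3 * real n) powr real k \<le> (3 * real n) powr (2 * real n powr (2/5))"
            using k n100 by (intro powr_mono) auto
          show "(7/8 :: real) powr real e \<le> (7/8) powr (real n powr (4/5))"
            using e by (intro powr_mono') auto
        qed (use k in auto)
        also have "\<dots> \<le> 1 / real n" using elim by blast
        finally have "real (\<Sum>i<k. (e choose i) * ((n - e) choose (s - i))) \<le> 1 / real n * N"
          using Npos by (simp add: mult_right_mono)
        moreover have "real n \<le> N / real n"
        proof -
          have "real n * real n \<le> N" using n4 Nn4 by linarith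
          then show ?thesis using n100 by (simp add: field_simps)
        qed
        moreover have "0 \<le> N / real n" using Npos by simp
        ultimately show ?thesis by simp
      qed
      have h: "s ^ k * (n choose (s - 1)) \<le> h * (s + e) ^ k"
        if s: "1 \<le> s" "s < n" "4 * s \<le> 3 * n" "N = real (n choose s)" for s
      proof -
        have "n choose (s - 1) \<le> 3 * (n choose s)" using binomial_lower_le[of s n 1] s by simp
        then have "real (n choose (s - 1)) \<le> 3 * N" using s(4) by linarith
        moreover have "real s \<le> real n / (real n + real e) * (real s + real e)"
          using s(1,2) n100 by (simp add: field_simps mult_left_mono)
        then have "real s ^ k \<le> \<rho> * (real s + real e) ^ k"
          unfolding \<rho>_def power_mult_distrib[symmetric] by (intro power_mono) auto
        ultimately have "real s ^ k * real (n choose (s - 1)) \<le> \<rho> * (real s + real e) ^ k * (3 * N)"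
          using \<rho>0 by (intro mult_mono) auto
        also have "\<dots> = 3 * N * \<rho> * (real s + real e) ^ k" by simp
        also have "\<dots> \<le> real h * (real s + real e) ^ k"
          unfolding h_def by (intro mult_right_mono) (linarith, simp)
        finally have "real (s ^ k * (n choose (s - 1))) \<le> real (h * (s + e) ^ k)" by simp
        then show ?thesis by (simp only: of_nat_le_iff)
      qed
      have nr: "real n - real r + 1 > 0" "real n - real r + 1 \<le> real n" "real n / 4 \<le> real n - real r + 1"
        using r r1 by linarith+
      have Kpos: "0 < K" unfolding K_def using r1 by simp
      have KN: "K / real r = N / (real n - real r + 1)"
        using K r1 nr by (simp add: field_simps)
      \<comment> \<open>The dominant cost: 2K/r equals 2N/(n - r + 1), and n - r is at least
        n/4.\<close>
      have a0: "2 * K / real r \<le> 8 * N / real n"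
      proof -
        have "N / (real n - real r + 1) \<le> N / (real n / 4)"
          using nr Npos n100 by (intro divide_left_mono) auto
        then show ?thesis using KN by simp
      qed
      have a0': "2 * N / real n \<le> 2 * K / real r"
      proof -
        have "N / real n \<le> N / (real n - real r + 1)"
          using nr Npos n100 by (intro divide_left_mono) auto
        then show ?thesis using KN by simp
      qed
      have \<delta>: "(real r)\<^sup>2 / (2 * K) = real r * (real n - real r + 1) / (2 * N)"
      proof -
        have "(real r)\<^sup>2 * (2 * N) = 2 * real r * (real r * N)" by (simp add: power2_eq_square)
        also have "\<dots> = real r * (real n - real r + 1) * (2 * K)" unfolding K by (simp only: mult_ac)
        finally show ?thesis using Kpos Npos by (simp add: frac_eq_eq)
      qed
      \<comment> \<open>On [n/4, 3n/4] the product r (n - r) is at least 3n^2/16, and 3/32 exceeds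
        1/11.\<close>
      have rn: "real n ^ 2 / 11 \<le> real r * (real n - real r + 1) / 2"
      proof -
        have "0 \<le> (real r - real n / 4) * (3 * real n / 4 - real r)"
          using r by (intro mult_nonneg_nonneg) linarith+
        moreover have "(real r - real n / 4) * (3 * real n / 4 - real r)
            = real n * real r - real r * real r - 3/16 * (real n * real n)" by algebra
        moreover have "0 \<le> real n * real n" by simp
        moreover have "real r * (real n - real r + 1) = real n * real r - real r * real r + real r"
          by algebra
        ultimately show ?thesis unfolding power2_eq_square by linarith
      qed
      have \<delta>_le: "(real r)\<^sup>2 / (2 * K) \<le> 1"
      proof -
        have "real r * (real n - real r + 1) \<le> real n * real n" using nr r1 by (intro mult_mono) auto
        also have "\<dots> \<le> real n ^ 4" by (rule n4)
        finally show ?thesis unfolding \<delta> using Nn4 Npos by (simp add: field_simps)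
      qed
      have \<delta>_ge: "real n ^ 2 / (11 * N) \<le> (real r)\<^sup>2 / (2 * K)"
        unfolding \<delta> using rn Npos by (simp add: field_simps)
      have q: "N * (1 - (real r)\<^sup>2 / (2 * K)) ^ q \<le> 2 * K / real r"
      proof -
        have "(1 - (real r)\<^sup>2 / (2 * K)) ^ q \<le> exp (- ((real r)\<^sup>2 / (2 * K))) ^ q"
          using \<delta>_le exp_ge_add_one_self[of "- ((real r)\<^sup>2 / (2 * K))"] by (intro power_mono) auto
        also have "\<dots> = exp (- ((real r)\<^sup>2 / (2 * K) * real q))"
          by (simp add: exp_of_nat_mult[symmetric] mult.commute)
        also have "\<dots> \<le> exp (- ln (real n))"
        proof -
          have "ln (real n) = real n ^ 2 / (11 * N) * (11 * N * ln (real n) / (real n)\<^sup>2)"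
            using Npos n100 by (simp add: field_simps)
          also have "\<dots> \<le> (real r)\<^sup>2 / (2 * K) * real q"
            using \<delta>_ge Npos n100 Kpos unfolding q_def by (intro mult_mono) (auto simp: real_nat_ceiling_ge)
          finally show ?thesis by simp
        qed
        also have "\<dots> = 1 / real n" using n100 by (simp add: exp_minus field_simps)
        finally have "N * (1 - (real r)\<^sup>2 / (2 * K)) ^ q \<le> N * (1 / real n)"
          using Npos by (intro mult_left_mono) auto
        also have "\<dots> \<le> 2 * N / real n" using Npos n100 by (simp add: field_simps)
        finally show ?thesis using a0' by linarith
      qed
      define g where "g = real ((n + 1) ^ (4 * e) + 1)"
      have W: "(\<Sum>s\<le>q. real ((n choose r) choose s) * g ^ s) \<le> 2 powr (3/4 * N / real n)"
      proof -
        have g1: "1 \<le> g" by (simp add: g_def)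
        \<comment> \<open>With x = 1/n^2 the factor exp (N/n^2) is harmless, and each recorded
          non-basis costs g n^2 \<le> (n + 1)^(4e + 3).\<close>
        have "(\<Sum>s\<le>q. real ((n choose r) choose s) * g ^ s)
            \<le> (g / (1 / (real n)\<^sup>2)) ^ q * exp (1 / (real n)\<^sup>2 * real (n choose r))"
          using n100 by (intro binomial_weight_le g1) auto
        also have "\<dots> = (g * (real n)\<^sup>2) ^ q * exp (N / (real n)\<^sup>2)" by (simp add: N_def)
        also have "\<dots> \<le> 2 powr (1/2 * N / real n) * 2 powr (1/4 * N / real n)"
        proof (rule mult_mono)
          have "g \<le> (real n + 1) * (real n + 1) ^ (4 * e)"
          proof -
            have "1 \<le> real n * (real n + 1) ^ (4 * e)"
              using n100 mult_mono[of 1 "real n" 1 "(real n + 1) ^ (4 * e)"] by simp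
            then show ?thesis by (simp add: g_def algebra_simps)
          qed
          then have "g * (real n)\<^sup>2 \<le> (real n + 1) * (real n + 1) ^ (4 * e) * (real n + 1)\<^sup>2"
            using g1 by (intro mult_mono power_mono) auto
          also have "\<dots> = (real n + 1) ^ (4 * e + 3)"
            by (simp add: power_add power2_eq_square power3_eq_cube mult_ac)
          finally have "(g * (real n)\<^sup>2) ^ q \<le> ((real n + 1) ^ (4 * e + 3)) ^ q"
            using g1 by (intro power_mono) auto
          also have "\<dots> = (real n + 1) powr (real q * (real (4 * e + 3)))"
            by (simp add: power_mult[symmetric] powr_realpow[symmetric] mult.commute powr_powr)
          also have "\<dots> = (2 powr log 2 (real n + 1)) powr (real q * (real (4 * e + 3)))" by simp
          also have "\<dots> = 2 powr (real q * ((4 * real e + 3) * log 2 (real n + 1)))"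
            unfolding powr_powr by (simp add: mult_ac)
          also have "\<dots> \<le> 2 powr (1/2 * N / real n)"
          proof (rule powr_mono)
            have qle: "real q \<le> N * (11 * ln (real n) / (real n)\<^sup>2 + 1 / real n ^ 4)"
            proof -
              have "0 \<le> 11 * N * ln (real n) / (real n)\<^sup>2" using Npos n100 by simp
              then have "real q \<le> 11 * N * ln (real n) / (real n)\<^sup>2 + 1" unfolding q_def by linarith
              then show ?thesis using Nn by (simp add: algebra_simps)
            qed
            have "real q * ((4 * real e + 3) * log 2 (real n + 1))
                \<le> N * (11 * ln (real n) / (real n)\<^sup>2 + 1 / real n ^ 4) *
                  ((8 * real n powr (4/5) + 3) * log 2 (real n + 1))"
              using qle e n100 Npos by (intro mult_mono) auto
            also have "\<dots> = N * ((11 * ln (real n) / (real n)\<^sup>2 + 1 / real n ^ 4) *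
                  ((8 * real n powr (4/5) + 3) * log 2 (real n + 1)))" by (simp only: mult.assoc)
            also have "\<dots> \<le> N * (1 / (2 * real n))" using elim Npos by (intro mult_left_mono) auto
            finally show "real q * ((4 * real e + 3) * log 2 (real n + 1)) \<le> 1/2 * N / real n" by simp
          qed simp
          finally show "(g * (real n)\<^sup>2) ^ q \<le> 2 powr (1/2 * N / real n)" .
          have "exp (N / (real n)\<^sup>2) = exp 1 powr (N / (real n)\<^sup>2)" by (simp add: powr_def)
          also have "\<dots> \<le> (2 powr 2) powr (N / (real n)\<^sup>2)"
            using Npos exp_le by (intro powr_mono2) auto
          also have "\<dots> = 2 powr (2 * N / (real n)\<^sup>2)" unfolding powr_powr by simp
          also have "\<dots> \<le> 2 powr (1/4 * N / real n)"
            using n100 Npos by (intro powr_mono) (auto simp: field_simps power2_eq_square)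
          finally show "exp (N / (real n)\<^sup>2) \<le> 2 powr (1/4 * N / real n)" .
        qed (use g1 in auto)
        also have "\<dots> = 2 powr (3/4 * N / real n)" by (simp add: powr_add[symmetric] field_simps)
        finally show ?thesis .
      qed
      have H: "(2 ^ n + 1 :: real) ^ (2 * h + 2) \<le> 2 powr (1/4 * N / real n)"
      proof -
        have "(2 ^ n + 1 :: real) ^ (2 * h + 2) \<le> (2 ^ (n + 1)) ^ (2 * h + 2)"
          by (intro power_mono) auto
        also have "\<dots> = 2 powr real ((n + 1) * (2 * h + 2))"
          unfolding power_mult[symmetric] by (rule powr_realpow[symmetric]) simp
        also have "real ((n + 1) * (2 * h + 2)) = (real n + 1) * (2 * real h + 2)"
          by (simp add: algebra_simps)
        also have "2 powr ((real n + 1) * (2 * real h + 2)) \<le> 2 powr (1/4 * N / real n)"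
        proof (rule powr_mono)
          have "real h \<le> 3 * N * \<rho> + 1"
          proof -
            have "0 \<le> 3 * N * \<rho>" using Npos \<rho>0 by simp
            then show ?thesis unfolding h_def by linarith
          qed
          then have "(real n + 1) * (2 * real h + 2) \<le> (real n + 1) * (6 * N * \<rho> + 4)"
            by (intro mult_left_mono) auto
          also have "\<dots> = (real n + 1) * 6 * \<rho> * N + 4 * (real n + 1)" by (simp add: algebra_simps)
          also have "(real n + 1) * 6 * \<rho> * N \<le> 1 / (8 * real n) * N"
            using \<rho> n100 Npos by (intro mult_right_mono) (auto simp: field_simps)
          also have "4 * (real n + 1) \<le> 1 / (8 * real n) * N"
          proof -
            have "32 * real n * (real n + 1) \<le> N" using n4 Nn4 by linarith
            then show ?thesis using n100 by (simp add: field_simps)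
          qed
          finally show "(real n + 1) * (2 * real h + 2) \<le> 1/4 * N / real n" by (simp add: field_simps)
        qed simp
        finally show ?thesis .
      qed
      \<comment> \<open>The budget in units of N/n: 8 for the vertices left over, 3/4 for the
        recorded non-bases with their patterns, 1/4 for the two lists of hyperplanes.\<close>
      define B where "B = 2 powr (9 * N / real n)"
      have t: "2 ^ (n + (\<Sum>i<k. (e choose i) * ((n - e) choose (s - i)))) \<le> B"
        if "n \<le> 4 * s" "4 * s \<le> 3 * n" "N = real (n choose s)" for s
        unfolding B_def powr_realpow[symmetric, of 2, simplified]
        by (rule powr_mono[OF small_T[OF that]]) simp
      have third: "(2 ^ n + 1) ^ (2 * h + 2) * (2 powr (2 * K / real r) *
          (\<Sum>s\<le>q. real ((n choose r) choose s) * g ^ s)) \<le> B"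
      proof -
        have "(2 ^ n + 1) ^ (2 * h + 2) * (2 powr (2 * K / real r) *
            (\<Sum>s\<le>q. real ((n choose r) choose s) * g ^ s))
            \<le> 2 powr (1/4 * N / real n) * (2 powr (8 * N / real n) * 2 powr (3/4 * N / real n))"
          using H W a0 by (intro mult_mono powr_mono mult_nonneg_nonneg sum_nonneg) (auto simp: g_def)
        also have "\<dots> = B" by (simp add: B_def powr_add[symmetric] field_simps)
        finally show ?thesis .
      qed
      have "real (card {\<B>. matroid {1..n} \<B> \<and> \<B> \<subseteq> ksets {1..n} r}) \<le> B + B + B"
      proof -
        have kr: "k < r" "k < r'" using k8 r r' n100 by linarith+
        have K2: "(real r)\<^sup>2 \<le> 2 * K" using \<delta>_le Kpos by (simp add: field_simps)
        have "real (card {\<B>. matroid {1..n} \<B> \<and> \<B> \<subseteq> ksets {1..n} r})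
            \<le> 2 ^ (n + (\<Sum>i<k. (e choose i) * ((n - e) choose (r - i))))
              + 2 ^ (n + (\<Sum>i<k. (e choose i) * ((n - e) choose (r' - i))))
              + (2 ^ n + 1) ^ (2 * h + 2) * (2 powr (2 * K / real r) *
                (\<Sum>s\<le>q. real ((n choose r) choose s) * g ^ s))"
          using card_matroids_rank_le[of "{1..n}" r k h e q] r1 kr h[of r] h[of r'] r r' N' K2 q
          by (simp add: N_def K_def r'_def g_def)
        moreover have "2 ^ (n + (\<Sum>i<k. (e choose i) * ((n - e) choose (r - i)))) \<le> B"
          using t[of r] r N_def by blast
        moreover have "2 ^ (n + (\<Sum>i<k. (e choose i) * ((n - e) choose (r' - i)))) \<le> B"
          using t[of r'] r' N' by blast
        ultimately show ?thesis using third by linarith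
      qed
      \<comment> \<open>The factor 4 is absorbed by one more unit of N/n, which gives the constant
        10.\<close>
      also have "B + B + B \<le> 2 powr 2 * B" by (simp add: B_def)
      also have "\<dots> = 2 powr (2 + 9 * N / real n)" by (simp add: B_def powr_add)
      also have "\<dots> \<le> 2 powr (10 * N / real n)"
      proof (rule powr_mono)
        have "2 * real n \<le> N" using n4 Nn4 by linarith
        then have "2 \<le> N / real n" using n100 by (simp add: field_simps)
        moreover have "10 * N / real n = 9 * N / real n + N / real n"
          by (simp add: add_divide_distrib[symmetric])
        ultimately show "2 + 9 * N / real n \<le> 10 * N / real n" by linarith
      qed simp
      finally show "real (card {\<B>. matroid {1..n} \<B> \<and> \<B> \<subseteq> ksets {1..n} r})
          \<le> 2 powr (10 * real (n choose r) / real n)" by (simp add: N_def)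
    qed
  qed
qed

section \<open>Ranks far from the middle\<close>

text \<open>If exchange fails for \<open>a\<close>, all sets A - a + c with c in
  \<open>B - A\<close> lie in \<open>S\<close>. They share A - a, so stability leaves a single c,
  and then \<open>B\<close> itself is A - a + c, contrary to B \<notin> S.\<close>

lemma sparse_paving_matroid:
  assumes finE: "finite E" and ne: "ksets E r - S \<noteq> {}"
    and stable: "\<And>Z b c. insert b Z \<in> S \<Longrightarrow> insert c Z \<in> S \<Longrightarrow> b \<notin> Z \<Longrightarrow> c \<notin> Z \<Longrightarrow>
      b \<in> E \<Longrightarrow> c \<in> E \<Longrightarrow> b = c"
  shows "matroid E (ksets E r - S)"
proof -
  have "\<exists>b\<in>B - A. insert b (A - {a}) \<in> ksets E r - S"
    if A: "A \<in> ksets E r - S" and B: "B \<in> ksets E r - S" and a: "a \<in> A - B" for A B a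
  proof (rule ccontr)
    assume no: "\<not> ?thesis"
    have f: "finite A" "A \<subseteq> E" "card A = r" "finite B" "B \<subseteq> E" "card B = r"
      using A B finite_subset[OF _ finE] by (auto simp: ksets_def)
    have swap: "insert b (A - {a}) \<in> ksets E r" if "b \<in> B - A" for b
      using that f a card_Suc_Diff1[of A a] by (auto simp: ksets_def)
    have "B - A \<noteq> {}" using a f card_subset_eq[of A B] by auto
    then obtain b where b: "b \<in> B - A" by blast
    have inS: "insert c (A - {a}) \<in> S" if "c \<in> B - A" for c
      using no swap[OF that] that by simp
    have only: "c = b" if "c \<in> B - A" for c
      using stable[OF inS[OF that] inS[OF b]] that b f by auto
    have "B \<subseteq> insert b (A - {a})"
    proof
      fix z assume "z \<in> B"
      then show "z \<in> insert b (A - {a})" using only[of z] a by (cases "z \<in> A") auto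
    qed
    moreover have "finite (insert b (A - {a}))" "card (insert b (A - {a})) = r"
      using swap[OF b] f by (auto simp: ksets_def)
    ultimately have "B = insert b (A - {a})" using f by (intro card_subset_eq) auto
    then show False using no b B by auto
  qed
  then show ?thesis using finE ne unfolding matroid_def by (auto simp: ksets_def)
qed

text \<open>Equal sums make n divide the difference of b and c, which is smaller than n. This is the
  Graham--Sloane colouring of the Johnson graph with n colours.\<close>

lemma sum_mod_stable:
  fixes n :: nat
  assumes "b \<notin> Z" "c \<notin> Z" "b \<in> {1..n}" "c \<in> {1..n}" "finite Z"
    and eq: "\<Sum>(insert b Z) mod n = \<Sum>(insert c Z) mod n"
  shows "b = c"
proof -
  have *: "x = y" if "x \<le> y" "1 \<le> x" "y \<le> n" "(y + t) mod n = (x + t) mod n" for x y t :: nat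
  proof -
    have "n dvd (y + t) - (x + t)" using that by (subst mod_eq_dvd_iff_nat[symmetric]) auto
    then have "n dvd y - x" by simp
    moreover have "y - x < n" using that by linarith
    ultimately have "y - x = 0" using nat_dvd_not_less by blast
    then show ?thesis using that(1) by simp
  qed
  have bc: "(b + \<Sum>Z) mod n = (c + \<Sum>Z) mod n" using eq assms(1,2,5) by simp
  show ?thesis
  proof (cases "b \<le> c")
    case True
    show ?thesis by (rule *[OF True _ _ bc[symmetric]]) (use assms(3,4) in simp_all)
  next
    case False
    then have "c \<le> b" by simp
    have "c = b" by (rule *[OF \<open>c \<le> b\<close> _ _ bc]) (use assms(3,4) in simp_all)
    then show ?thesis by simp
  qed
qed

lemma card_matroids_ge:
  assumes n: "2 \<le> n"
  shows "2 powr (real (n choose (n div 2)) / real n) \<le> real (card (matroids n))"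
proof -
  define r where "r = n div 2"
  define E where "E = {1..n}"
  define C where "C = (\<lambda>c. {X \<in> ksets E r. \<Sum>X mod n = c})"
  have finE: "finite E" and cE: "card E = n" by (auto simp: E_def)
  have r: "1 \<le> r" "r < n" using n by (auto simp: r_def)
  have finC: "finite (C c)" for c using finE by (simp add: C_def)
  have "ksets E r = (\<Union>c<n. C c)" using n by (auto simp: C_def)
  then have "card (ksets E r) = (\<Sum>c<n. card (C c))"
    using finC by (simp only:) (rule card_UN_disjoint, auto simp: C_def)
  then have N: "real (n choose r) = (\<Sum>c<n. real (card (C c)))"
    using card_ksets[OF finE, of r] cE by simp
  have "\<exists>c<n. real (n choose r) / real n \<le> real (card (C c))"
  proof (rule ccontr)
    assume "\<not> ?thesis"
    then have "(\<Sum>c<n. real (card (C c))) < (\<Sum>c<n. real (n choose r) / real n)"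
      using n by (intro sum_strict_mono) (auto simp: not_le lessThan_empty_iff)
    then show False using N n by simp
  qed
  then obtain c where c: "real (n choose r) / real n \<le> real (card (C c))" by blast
  have stable: "x = y" if "insert x Z \<in> C c" "insert y Z \<in> C c" "x \<notin> Z" "y \<notin> Z" "x \<in> E" "y \<in> E" for x y Z
  proof (rule sum_mod_stable[of x Z y n])
    show "finite Z" using that(1) finite_subset[OF _ finE] by (auto simp: C_def ksets_def)
  qed (use that in \<open>auto simp: C_def E_def\<close>)
  have "matroid E (ksets E r - S)" if S: "S \<subseteq> C c" for S
  proof (rule sparse_paving_matroid[OF finE])
    show "x = y" if "insert x Z \<in> S" "insert y Z \<in> S" "x \<notin> Z" "y \<notin> Z" "x \<in> E" "y \<in> E" for x y Z
      using stable that S by blast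
    \<comment> \<open>Some basis must remain: two r-sets with a common (r-1)-subset are adjacent, so
      they are not both removed.\<close>
    have "r - 1 \<le> card E" using cE r by simp
    then obtain Z where Z: "Z \<subseteq> E" "card Z = r - 1"
      using obtain_subset_with_card_n by metis
    have fZ: "finite Z" using Z finE finite_subset by auto
    have "card (E - Z) \<ge> 2" using Z fZ cE r by (simp add: card_Diff_subset)
    then obtain T where "T \<subseteq> E - Z" "card T = 2" using obtain_subset_with_card_n by metis
    then obtain x y where xy: "x \<in> E - Z" "y \<in> E - Z" "x \<noteq> y" by (auto simp: card_2_iff)
    then have "insert x Z \<in> ksets E r" "insert y Z \<in> ksets E r"
      using Z fZ r by (auto simp: ksets_def)
    moreover have "insert x Z \<notin> S \<or> insert y Z \<notin> S" using stable[of x Z y] xy S by blast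
    ultimately show "ksets E r - S \<noteq> {}" by blast
  qed
  then have "(\<lambda>S. ksets E r - S) ` Pow (C c) \<subseteq> matroids n" by (auto simp: matroids_def E_def)
  moreover have "inj_on (\<lambda>S. ksets E r - S) (Pow (C c))"
  proof (rule inj_onI)
    fix S T assume "S \<in> Pow (C c)" "T \<in> Pow (C c)" "ksets E r - S = ksets E r - T"
    moreover have "C c \<subseteq> ksets E r" by (auto simp: C_def)
    ultimately show "S = T" by blast
  qed
  ultimately have "card (Pow (C c)) \<le> card (matroids n)"
    using finite_matroids by (intro card_inj_on_le)
  then have "2 ^ card (C c) \<le> card (matroids n)" using finC by (simp add: card_Pow)
  then have "(2::real) ^ card (C c) \<le> real (card (matroids n))"
    by (metis of_nat_le_iff of_nat_numeral of_nat_power)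
  moreover have "2 powr (real (n choose r) / real n) \<le> 2 ^ card (C c)"
    using c by (simp add: powr_realpow[symmetric])
  ultimately have "2 powr (real (n choose r) / real n) \<le> real (card (matroids n))"
    by (rule order_trans[rotated])
  then show ?thesis by (simp only: r_def)
qed

section \<open>Binomial decay and the ranks away from the middle\<close>

text \<open>While j stays at distance at least h below the middle, the ratio (j + 1)/(n - j) of
  consecutive coefficients is at most 1 - 2h/n. A start at distance 2h allows h such steps; the rest
  of the way is covered by the maximality of the middle coefficient.\<close>

lemma binomial_tail:
  assumes h: "i + 2 * h \<le> n div 2" and n: "0 < n"
  shows "real (n choose i) \<le> exp (- 2 * (real h)\<^sup>2 / real n) * real (n choose (n div 2))"
proof -
  have step: "real (n choose j) \<le> exp (- 2 * real h / real n) * real (n choose Suc j)"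
    if j: "Suc j + h \<le> n div 2" for j
  proof -
    have jn: "2 * j + 2 + 2 * h \<le> n" using j by linarith
    have le: "real (Suc j) \<le> real (n - j) * exp (- 2 * real h / real n)"
    proof -
      have "real (n - j) * (2 * real h / real n) \<le> real n * (2 * real h / real n)"
        by (intro mult_right_mono) auto
      also have "\<dots> = 2 * real h" using n by simp
      finally have "real (Suc j) \<le> real (n - j) - real (n - j) * (2 * real h / real n)"
        using jn by linarith
      also have "\<dots> = real (n - j) * (1 + - 2 * real h / real n)" by (simp add: right_diff_distrib)
      also have "\<dots> \<le> real (n - j) * exp (- 2 * real h / real n)"
        by (intro mult_left_mono exp_ge_add_one_self) auto
      finally show ?thesis .
    qed
    have "real (n - j) * real (n choose j) = real (Suc j) * real (n choose Suc j)"
      using binomial_step[of n j] by (simp only: of_nat_mult[symmetric])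
    also have "\<dots> \<le> real (n - j) * exp (- 2 * real h / real n) * real (n choose Suc j)"
      by (rule mult_right_mono[OF le]) simp
    finally have "real (n - j) * real (n choose j)
        \<le> real (n - j) * (exp (- 2 * real h / real n) * real (n choose Suc j))"
      by (simp only: mult.assoc)
    moreover have "0 < real (n - j)" using jn by simp
    ultimately show ?thesis by (simp only: mult_le_cancel_left_pos)
  qed
  have "real (n choose i) \<le> exp (- 2 * real h / real n) ^ j * real (n choose (i + j))"
    if "i + j + h \<le> n div 2" for j
    using that
  proof (induction j)
    case (Suc j)
    have "real (n choose i) \<le> exp (- 2 * real h / real n) ^ j * real (n choose (i + j))"
      using Suc by simp
    also have "\<dots> \<le> exp (- 2 * real h / real n) ^ j *
        (exp (- 2 * real h / real n) * real (n choose Suc (i + j)))"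
      using Suc.prems by (intro mult_left_mono step) auto
    finally show ?case by (simp only: power_Suc2 mult.assoc add_Suc_right)
  qed simp
  from this[of h] have "real (n choose i) \<le> exp (- 2 * real h / real n) ^ h * real (n choose (i + h))"
    using h by simp
  also have "\<dots> \<le> exp (- 2 * real h / real n) ^ h * real (n choose (n div 2))"
    by (intro mult_left_mono) (simp_all add: binomial_maximum)
  also have "exp (- 2 * real h / real n) ^ h = exp (- 2 * (real h)\<^sup>2 / real n)"
    by (simp add: exp_of_nat_mult[symmetric] power2_eq_square mult_ac)
  finally show ?thesis .
qed

text \<open>The target 1/4 needs only to be below 1, the constant of the lower bound. Ranks in
  [n/4, 3n/4] reach it through 10/40, the others through the trivial count of all families of
  r-sets.\<close>

lemma card_matroids_far_rank:
  "\<forall>\<^sub>F n in sequentially. \<forall>r\<le>n. 10 * sqrt (real n) \<le> \<bar>real r - real n / 2\<bar> \<longrightarrow>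
    real (card {\<B>. matroid {1..n} \<B> \<and> \<B> \<subseteq> ksets {1..n} r})
      \<le> 2 powr (1/4 * real (n choose (n div 2)) / real n)"
proof -
  have ev: "\<forall>\<^sub>F n in sequentially. 100 \<le> n \<and> exp (- real n / 512) \<le> 1 / (4 * real n)"
    by (intro eventually_conj eventually_ge_at_top; real_asymp)
  show ?thesis
    using ev card_matroids_middle_rank
  proof eventually_elim
    case (elim n)
    show ?case
    proof (intro allI impI)
      fix r assume rn: "r \<le> n" and far: "10 * sqrt (real n) \<le> \<bar>real r - real n / 2\<bar>"
      define N where "N = real (n choose (n div 2))"
      define s where "s = min r (n - r)"
      have n100: "100 \<le> n" using elim by simp
      have sq: "10 \<le> sqrt (real n)" using n100 real_le_rsqrt[of 10 "real n"] by simp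
      have s: "n choose r = n choose s" using rn binomial_symmetric[OF rn] by (simp add: s_def min_def)
      have s_le: "real s \<le> real n / 2 - 10 * sqrt (real n)"
        using far rn unfolding s_def by (auto simp: min_def abs_if of_nat_diff split: if_splits)
      have N0: "0 \<le> N" by (simp add: N_def)
      show "real (card {\<B>. matroid {1..n} \<B> \<and> \<B> \<subseteq> ksets {1..n} r}) \<le>
          2 powr (1/4 * real (n choose (n div 2)) / real n)"
      proof (cases "n \<le> 4 * r \<and> 4 * r \<le> 3 * n")
        case True
        \<comment> \<open>Twice h must fit into 10 sqrt n after rounding, and 2 (9/2)^2 = 81/2
          exceeds the 40 needed below.\<close>
        define h where "h = nat \<lceil>9/2 * sqrt (real n)\<rceil>"
        have h: "9/2 * sqrt (real n) \<le> real h" "real h \<le> 9/2 * sqrt (real n) + 1"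
          using sq unfolding h_def by linarith+
        have "real s + 2 * real h \<le> real n / 2 - 1" using s_le h sq by linarith
        then have "s + 2 * h \<le> n div 2" by linarith
        then have "real (n choose s) \<le> exp (- 2 * (real h)\<^sup>2 / real n) * N"
          unfolding N_def using n100 by (intro binomial_tail) auto
        also have "exp (- 2 * (real h)\<^sup>2 / real n) \<le> 1 / 40"
        proof -
          have "(9/2 * sqrt (real n))\<^sup>2 \<le> (real h)\<^sup>2" using h sq by (intro power_mono) auto
          then have "40 \<le> 2 * (real h)\<^sup>2 / real n" using n100 by (simp add: field_simps power_mult_distrib)
          moreover have "1 + 2 * (real h)\<^sup>2 / real n \<le> exp (2 * (real h)\<^sup>2 / real n)"
            by (rule exp_ge_add_one_self)
          ultimately have "40 \<le> exp (2 * (real h)\<^sup>2 / real n)" by linarith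
          then show ?thesis by (simp add: exp_minus field_simps)
        qed
        finally have "real (n choose r) \<le> 1 / 40 * N" using N0 s by (simp add: mult_right_mono)
        then have "10 * real (n choose r) / real n \<le> 1/4 * N / real n"
          by (intro divide_right_mono) auto
        then have "2 powr (10 * real (n choose r) / real n) \<le> 2 powr (1/4 * N / real n)"
          by (intro powr_mono) auto
        then show ?thesis using elim(2) True unfolding N_def by (meson order_trans)
      next
        case False
        \<comment> \<open>Here s \<le> n/4, so twice h fits easily. Rounding still leaves h \<ge>
          n/32, and 2 (n/32)^2 / n = n/512.\<close>
        define h where "h = n div 16"
        have "4 * s \<le> n" using False rn by (auto simp: s_def min_def)
        then have "s + 2 * h \<le> n div 2" using n100 unfolding h_def by linarith
        then have "real (n choose s) \<le> exp (- 2 * (real h)\<^sup>2 / real n) * N"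
          unfolding N_def using n100 by (intro binomial_tail) auto
        also have "exp (- 2 * (real h)\<^sup>2 / real n) \<le> exp (- real n / 512)"
        proof -
          have "n \<le> 32 * h" using n100 unfolding h_def by linarith
          then have "real n / 32 \<le> real h" by linarith
          then have "(real n / 32)\<^sup>2 \<le> (real h)\<^sup>2" by (intro power_mono) auto
          then show ?thesis using n100 by (simp add: field_simps power2_eq_square)
        qed
        also have "\<dots> \<le> 1 / (4 * real n)" using elim by blast
        finally have "real (n choose r) \<le> 1 / (4 * real n) * N" using N0 s by (simp add: mult_right_mono)
        then have b: "real (n choose r) \<le> 1/4 * N / real n" by simp
        have "card {\<B>. matroid {1..n} \<B> \<and> \<B> \<subseteq> ksets {1..n} r} \<le> card (Pow (ksets {1..n} r))"
          by (intro card_mono) auto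
        also have "\<dots> = 2 ^ (n choose r)" by (simp add: card_Pow card_ksets)
        finally have "real (card {\<B>. matroid {1..n} \<B> \<and> \<B> \<subseteq> ksets {1..n} r}) \<le> 2 ^ (n choose r)"
          using of_nat_le_iff[of _ "2 ^ (n choose r)", where 'a=real] by simp
        also have "\<dots> = 2 powr real (n choose r)" by (simp add: powr_realpow)
        also have "\<dots> \<le> 2 powr (1/4 * N / real n)" by (rule powr_mono[OF b]) simp
        finally show ?thesis by (simp add: N_def)
      qed
    qed
  qed
qed

section \<open>Summation over the ranks and the limit\<close>

lemma matroid_rank_ksets:
  assumes "matroid E \<B>"
  shows "\<B> \<subseteq> ksets E (matroid_rank \<B>)" "matroid_rank \<B> \<le> card E"
proof -
  show "\<B> \<subseteq> ksets E (matroid_rank \<B>)"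
    using assms matroid_rank_eq[OF assms] by (auto simp: ksets_def matroid_def)
  obtain B where "B \<in> \<B>" "B \<subseteq> E" using assms by (auto simp: matroid_def)
  then show "matroid_rank \<B> \<le> card E"
    using matroid_rank_eq[OF assms, of B] card_mono[OF matroid_finite[OF assms], of B] by simp
qed

text \<open>At most n + 1 ranks contribute 2^{N/(4n)} each, against 2^{N/n} matroids in total; N
  \<ge> n^4 makes the quotient explicit.\<close>

lemma card_matroids_far:
  "\<forall>\<^sub>F n in sequentially.
    real (card {\<B> \<in> matroids n. 10 * sqrt (real n) \<le> \<bar>real (matroid_rank \<B>) - real n / 2\<bar>})
      \<le> (real n + 1) * 2 powr (- 3/4 * real n ^ 3) * real (card (matroids n))"
proof -
  have ev: "\<forall>\<^sub>F n in sequentially. 100 \<le> n \<and> real n ^ 4 \<le> (4/3) powr (real n / 4)"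
    by (intro eventually_conj eventually_ge_at_top; real_asymp)
  show ?thesis
    using ev card_matroids_far_rank
  proof eventually_elim
    case (elim n)
    define N where "N = real (n choose (n div 2))"
    define R where "R = {r. r \<le> n \<and> 10 * sqrt (real n) \<le> \<bar>real r - real n / 2\<bar>}"
    define F where "F = {\<B> \<in> matroids n. 10 * sqrt (real n) \<le> \<bar>real (matroid_rank \<B>) - real n / 2\<bar>}"
    have n100: "100 \<le> n" using elim by simp
    have RS: "R \<subseteq> {..n}" by (auto simp: R_def)
    then have finR: "finite R" and cR: "card R \<le> n + 1"
      using finite_subset card_mono[OF _ RS] by auto
    have "F \<subseteq> (\<Union>r\<in>R. {\<B>. matroid {1..n} \<B> \<and> \<B> \<subseteq> ksets {1..n} r})"
    proof
      fix \<B> assume "\<B> \<in> F"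
      then have m: "matroid {1..n} \<B>" and "10 * sqrt (real n) \<le> \<bar>real (matroid_rank \<B>) - real n / 2\<bar>"
        by (auto simp: F_def matroids_def)
      then have "matroid_rank \<B> \<in> R" using matroid_rank_ksets(2)[OF m] by (simp add: R_def)
      then show "\<B> \<in> (\<Union>r\<in>R. {\<B>. matroid {1..n} \<B> \<and> \<B> \<subseteq> ksets {1..n} r})"
        using m matroid_rank_ksets(1)[OF m] by blast
    qed
    moreover have "finite {\<B>. matroid {1..n} \<B> \<and> \<B> \<subseteq> ksets {1..n} r}" for r
      by (rule finite_subset[of _ "Pow (ksets {1..n} r)"]) auto
    ultimately have "card F \<le> card (\<Union>r\<in>R. {\<B>. matroid {1..n} \<B> \<and> \<B> \<subseteq> ksets {1..n} r})"
      using finR by (intro card_mono) auto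
    also have "\<dots> \<le> (\<Sum>r\<in>R. card {\<B>. matroid {1..n} \<B> \<and> \<B> \<subseteq> ksets {1..n} r})"
      by (rule card_UN_le[OF finR])
    finally have "real (card F) \<le> (\<Sum>r\<in>R. real (card {\<B>. matroid {1..n} \<B> \<and> \<B> \<subseteq> ksets {1..n} r}))"
      by (simp only: of_nat_sum[symmetric] of_nat_le_iff)
    also have "\<dots> \<le> real (card R) * 2 powr (1/4 * N / real n)"
      using elim(2) by (intro sum_bounded_above) (auto simp: R_def N_def)
    also have "\<dots> \<le> (real n + 1) * 2 powr (1/4 * N / real n)"
      using cR by (intro mult_right_mono) auto
    also have "2 powr (1/4 * N / real n) \<le> 2 powr (- 3/4 * real n ^ 3) * 2 powr (N / real n)"
    proof -
      have "real n ^ 4 \<le> N"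
        using binomial_middle_ge[of n "n div 2"] n100 elim(1) unfolding N_def by linarith
      then have "real n ^ 3 \<le> N / real n" using n100
        by (simp add: pos_le_divide_eq power4_eq_xxxx power3_eq_cube)
      moreover have "1/4 * N / real n = 1/4 * (N / real n)" by simp
      ultimately have "1/4 * N / real n \<le> - 3/4 * real n ^ 3 + N / real n" by linarith
      then show ?thesis by (simp add: powr_add[symmetric])
    qed
    also have "2 powr (N / real n) \<le> real (card (matroids n))"
      unfolding N_def using n100 by (intro card_matroids_ge) simp
    finally show ?case unfolding F_def by (simp add: mult.assoc mult_left_mono)
  qed
qed

theorem theorem11:
  shows "\<exists>\<beta>\<^sub>0::real. \<forall>\<beta>>\<beta>\<^sub>0.
    (\<lambda>n. matroid_fraction
       (\<lambda>\<B>. real n / 2 - \<beta> * sqrt (real n) < real (matroid_rank \<B>) \<and>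
             real (matroid_rank \<B>) < real n / 2 + \<beta> * sqrt (real n)) n)
    \<longlonglongrightarrow> 1"
proof (intro exI[of _ 10] allI impI)
  fix \<beta> :: real assume \<beta>: "10 < \<beta>"
  define P where "P = (\<lambda>n (\<B> :: nat set set). real n / 2 - \<beta> * sqrt (real n) < real (matroid_rank \<B>) \<and>
      real (matroid_rank \<B>) < real n / 2 + \<beta> * sqrt (real n))"
  have "(\<lambda>n. matroid_fraction (P n) n) \<longlonglongrightarrow> 1"
  proof (rule tendsto_sandwich)
    show "\<forall>\<^sub>F n in sequentially. 1 - (real n + 1) * 2 powr (- 3/4 * real n ^ 3) \<le> matroid_fraction (P n) n"
      using card_matroids_far
    proof eventually_elim
      case (elim n)
      let ?F = "{\<B> \<in> matroids n. 10 * sqrt (real n) \<le> \<bar>real (matroid_rank \<B>) - real n / 2\<bar>}"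
      let ?G = "{\<B> \<in> matroids n. P n \<B>}"
      \<comment> \<open>A matroid outside the window of width \<beta> is also outside the one of
        width 10, so one estimate serves every \<beta> > 10.\<close>
      have "10 * sqrt (real n) \<le> \<beta> * sqrt (real n)" using \<beta> by (intro mult_right_mono) auto
      then have "matroids n \<subseteq> ?G \<union> ?F" by (auto simp: P_def)
      then have "card (matroids n) \<le> card (?G \<union> ?F)"
        using finite_matroids by (intro card_mono) auto
      also have "\<dots> \<le> card ?G + card ?F" by (rule card_Un_le)
      finally have "real (card (matroids n)) \<le> real (card ?G) + real (card ?F)"
        by (simp only: of_nat_add[symmetric] of_nat_le_iff)
      then have "(1 - (real n + 1) * 2 powr (- 3/4 * real n ^ 3)) * real (card (matroids n)) \<le> real (card ?G)"
        using elim unfolding left_diff_distrib by linarith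
      then show ?case
        using card_matroids_pos[of n] unfolding matroid_fraction_def by (simp only: pos_le_divide_eq of_nat_0_less_iff)
    qed
    show "\<forall>\<^sub>F n in sequentially. matroid_fraction (P n) n \<le> 1"
    proof (intro always_eventually allI)
      fix n
      have "card {\<B> \<in> matroids n. P n \<B>} \<le> card (matroids n)"
        using finite_matroids by (intro card_mono) auto
      then show "matroid_fraction (P n) n \<le> 1"
        using card_matroids_pos[of n] unfolding matroid_fraction_def by simp
    qed
    show "(\<lambda>n. 1 - (real n + 1) * 2 powr (- 3/4 * real n ^ 3)) \<longlonglongrightarrow> 1" by real_asymp
  qed simp
  then show "(\<lambda>n. matroid_fraction
       (\<lambda>\<B>. real n / 2 - \<beta> * sqrt (real n) < real (matroid_rank \<B>) \<and>
             real (matroid_rank \<B>) < real n / 2 + \<beta> * sqrt (real n)) n) \<longlonglongrightarrow> 1"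
    unfolding P_def .
qed

end
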